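(* Let $F_2=\langle a,b\rangle$ be the free group of rank two and let $\mathbb E=\{0/1,1/0,1/1\}$. (1) If $u\in F_2$ is a positive primitive element of type $\eta\in\mathbb E$, then for each $\eta'\in\mathbb E$ with $\eta'\ne\eta$ there is exactly one conjugate $u'$ of $u$ in $F_2$ which is positive and palindromic with respect to $(\eta,\eta')$. (2) If $(u,v)$ is a positive generator pair of $F_2$ of type $(\eta,\eta')$, then there is exactly one generator pair $(u',v')$ conjugate to $(u,v)$ which is positive and palindromic with respect to $(\eta,\eta')$.
   Context: A generator pair is a pair $(u,v)$ of elements freely generating $F_2$; an element of $F_2$ is primitive (also called a generator) if it belongs to a generator pair. Two generator pairs $(u,v)$ and $(u',v')$ are conjugate if there is a single $g\in F_2$ with $gug^{-1}=u'$ and $gvg^{-1}=v'$. Positivity. An element $w\in F_2$, written as a reduced word in $a^{\pm1},b^{\pm1}$, is positive if it is cyclically shortest (the word and all its cyclic permutations are reduced) and all exponents of $a$ in it are positive. A generator pair $(u,v)$ is positive if both $u$ and $v$ are positive. Types. Primitive elements up to conjugacy and inversion are enumerated by $\mathbb Q\cup\{\infty\}$, with $a$ corresponding to $0/1$, $b$ to $1/0$ and $ab$ to $1/1$; the type of a primitive element in class $p/q$ is $\bar p/\bar q\in\mathbb E$, where $\bar p,\bar q\in\{0,1\}$ are the reductions of $p,q$ mod $2$. Equivalently, a primitive element has type $0/1$ if its exponent sum in $a$ is odd and in $b$ is even, type $1/0$ if its exponent sum in $a$ is even and in $b$ is odd, and type $1/1$ if both exponent sums are odd. A generator pair $(u,v)$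 has type $(\eta,\eta')$ if $u$ has type $\eta$ and $v$ has type $\eta'$. Palindromes. The basic generator pairs are the unordered pairs $(a,b)$, $(a,ab)$ and $(b,ab)$, corresponding to the pairs of types $(0/1,1/0)$, $(0/1,1/1)$ and $(1/0,1/1)$ respectively. For distinct $\eta,\eta'\in\mathbb E$, an element is palindromic with respect to $(\eta,\eta')$ if, when rewritten as a reduced word in the basic generator pair corresponding to $\{\eta,\eta'\}$ and inverses, it reads the same forwards and backwards. A generator pair is palindromic with respect to $(\eta,\eta')$ if both its elements are. *)

theory Defs
  imports "HOL-Algebra.Group"
begin

section \<open>The free group on two letters, as reduced words\<close>

datatype letter = La | Lb

text \<open>A signed letter \<open>(x, True)\<close> stands for \<open>x\<close> and \<open>(x, False)\<close> for its inverse.\<close>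

type_synonym word = "(letter \<times> bool) list"

definition inv_letter :: "letter \<times> bool \<Rightarrow> letter \<times> bool" where
  "inv_letter x = (fst x, \<not> snd x)"

definition reduced :: "word \<Rightarrow> bool" where
  "reduced = successively (\<lambda>x y. y \<noteq> inv_letter x)"

fun push :: "letter \<times> bool \<Rightarrow> word \<Rightarrow> word" where
  "push x [] = [x]"
| "push x (y # ys) = (if y = inv_letter x then ys else x # y # ys)"

definition reduce :: "word \<Rightarrow> word" where
  "reduce w = foldr push w []"

definition F2 :: "word monoid" where
  "F2 = \<lparr>carrier = {w. reduced w}, monoid.mult = (\<lambda>v w. reduce (v @ w)), one = []\<rparr>"

definition gen_a :: word where "gen_a = [(La, True)]"

definition gen_b :: word where "gen_b = [(Lb, True)]"

lemma inv_letter_inv_letter [simp]: "inv_letter (inv_letter x) = x"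
  by (simp add: inv_letter_def)

lemma reduced_Nil [simp]: "reduced []"
  by (simp add: reduced_def)

lemma reduced_Cons: "reduced (x # xs) \<longleftrightarrow> reduced xs \<and> (xs = [] \<or> hd xs \<noteq> inv_letter x)"
  by (auto simp: reduced_def successively_Cons)

lemma reduced_push: "reduced w \<Longrightarrow> reduced (push x w)"
  by (cases w) (auto simp: reduced_Cons)

lemma reduced_foldr_push: "reduced w \<Longrightarrow> reduced (foldr push v w)"
  by (induction v) (auto intro: reduced_push)

lemma reduced_reduce [simp]: "reduced (reduce w)"
  by (simp add: reduce_def reduced_foldr_push)

lemma reduce_reduced: "reduced w \<Longrightarrow> reduce w = w"
proof (induction w)
  case (Cons x xs)
  then show ?case by (cases xs) (auto simp: reduce_def reduced_Cons)
qed (simp add: reduce_def)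

lemma push_cancel: "reduced w \<Longrightarrow> push x (push (inv_letter x) w) = w"
proof (cases w)
  case (Cons y ys)
  assume "reduced w"
  then show ?thesis using Cons by (cases ys) (auto simp: reduced_Cons)
qed simp

lemma foldr_push_push:
  assumes "reduced w"
  shows "foldr push (push x v) w = push x (foldr push v w)"
proof (cases v)
  case (Cons y ys)
  then show ?thesis
    using push_cancel[OF reduced_foldr_push[OF assms], of x ys] by auto
qed simp

lemma foldr_push_reduce:
  assumes "reduced w"
  shows "foldr push (reduce v) w = foldr push v w"
  by (induction v) (auto simp: reduce_def foldr_push_push[OF assms])

lemma reduce_append: "reduce (v @ w) = foldr push v (reduce w)"
  by (simp add: reduce_def)

lemma reduce_append_reduce: "reduce (reduce v @ w) = reduce (v @ w)" "reduce (v @ reduce w) = reduce (v @ w)"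
  by (simp_all add: reduce_append foldr_push_reduce reduce_reduced)

lemma reduce_inverse: "reduce (rev (map inv_letter w) @ w) = []"
proof (induction w)
  case Nil
  then show ?case by (simp add: reduce_def)
next
  case (Cons x xs)
  have "push (inv_letter x) (push x (reduce xs)) = reduce xs"
    using push_cancel[of "reduce xs" "inv_letter x"] by simp
  then have "reduce (rev (map inv_letter (x # xs)) @ x # xs) = reduce (rev (map inv_letter xs) @ xs)"
    by (simp add: reduce_def)
  then show ?case using Cons by simp
qed

lemma group_F2: "group F2"
proof (rule groupI)
  fix x y z assume "x \<in> carrier F2" "y \<in> carrier F2" "z \<in> carrier F2"
  then show "x \<otimes>\<^bsub>F2\<^esub> y \<otimes>\<^bsub>F2\<^esub> z = x \<otimes>\<^bsub>F2\<^esub> (y \<otimes>\<^bsub>F2\<^esub> z)"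
    by (simp add: F2_def reduce_append_reduce)
next
  fix x assume "x \<in> carrier F2"
  moreover have "reduce (reduce (rev (map inv_letter x)) @ x) = []"
    by (simp add: reduce_append_reduce reduce_inverse)
  ultimately show "\<exists>y\<in>carrier F2. y \<otimes>\<^bsub>F2\<^esub> x = \<one>\<^bsub>F2\<^esub>"
    by (intro bexI[of _ "reduce (rev (map inv_letter x))"]) (simp_all add: F2_def)
qed (simp_all add: F2_def reduce_reduced)


section \<open>Generator pairs and primitive elements\<close>

text \<open>The element of \<^term>\<open>F2\<close> obtained from \<open>w\<close> by replacing the first letter by \<open>x\<close>
  and the second one by \<open>y\<close>.\<close>

definition subst_word :: "word \<Rightarrow> word \<Rightarrow> word \<Rightarrow> word" where
  "subst_word x y w =
     foldr (\<lambda>(l, s) r. (let z = (if l = La then x else y) in if s then z else inv\<^bsub>F2\<^esub> z) \<otimes>\<^bsub>F2\<^esub> r)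
       w \<one>\<^bsub>F2\<^esub>"

definition generator_pair :: "word \<times> word \<Rightarrow> bool" where
  "generator_pair p \<longleftrightarrow> fst p \<in> carrier F2 \<and> snd p \<in> carrier F2 \<and>
     (\<forall>g \<in> carrier F2. \<exists>!w. reduced w \<and> subst_word (fst p) (snd p) w = g)"

definition primitive :: "word \<Rightarrow> bool" where
  "primitive u \<longleftrightarrow> (\<exists>v. generator_pair (u, v) \<or> generator_pair (v, u))"

definition conjugate :: "word \<Rightarrow> word \<Rightarrow> bool" where
  "conjugate u u' \<longleftrightarrow> (\<exists>g \<in> carrier F2. g \<otimes>\<^bsub>F2\<^esub> u \<otimes>\<^bsub>F2\<^esub> inv\<^bsub>F2\<^esub> g = u')"

definition conjugate_pair :: "word \<times> word \<Rightarrow> word \<times> word \<Rightarrow> bool" where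
  "conjugate_pair p p' \<longleftrightarrow> (\<exists>g \<in> carrier F2.
     g \<otimes>\<^bsub>F2\<^esub> fst p \<otimes>\<^bsub>F2\<^esub> inv\<^bsub>F2\<^esub> g = fst p' \<and> g \<otimes>\<^bsub>F2\<^esub> snd p \<otimes>\<^bsub>F2\<^esub> inv\<^bsub>F2\<^esub> g = snd p')"


section \<open>Positivity\<close>

definition cyclically_shortest :: "word \<Rightarrow> bool" where
  "cyclically_shortest w \<longleftrightarrow> (\<forall>n. reduced (rotate n w))"

text \<open>Exponents of the second letter are unrestricted; a word without the first letter
  satisfies the exponent condition vacuously.\<close>

definition positive :: "word \<Rightarrow> bool" where
  "positive w \<longleftrightarrow> cyclically_shortest w \<and> (La, False) \<notin> set w"

definition positive_pair :: "word \<times> word \<Rightarrow> bool" where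
  "positive_pair p \<longleftrightarrow> positive (fst p) \<and> positive (snd p)"


section \<open>Types\<close>

text \<open>\<open>E01\<close>, \<open>E10\<close>, \<open>E11\<close> stand for \<open>0/1\<close>, \<open>1/0\<close>, \<open>1/1\<close>. A primitive element in the
  class \<open>p/q\<close> has, up to a common sign, exponent sum \<open>p\<close> in \<open>b\<close> and \<open>q\<close> in \<open>a\<close>.\<close>

datatype etype = E01 | E10 | E11

definition exponent_sum :: "letter \<Rightarrow> word \<Rightarrow> int" where
  "exponent_sum l w = (\<Sum>x\<leftarrow>w. if fst x = l then (if snd x then 1 else - 1) else 0)"

fun has_type :: "word \<Rightarrow> etype \<Rightarrow> bool" where
  "has_type u E01 \<longleftrightarrow> odd (exponent_sum La u) \<and> even (exponent_sum Lb u)"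
| "has_type u E10 \<longleftrightarrow> even (exponent_sum La u) \<and> odd (exponent_sum Lb u)"
| "has_type u E11 \<longleftrightarrow> odd (exponent_sum La u) \<and> odd (exponent_sum Lb u)"


section \<open>Palindromes\<close>

text \<open>The basic generator pair of \<open>{\<eta>, \<eta>'}\<close> consists of the elements of types \<open>\<eta>\<close> and \<open>\<eta>'\<close>
  among \<open>a\<close>, \<open>b\<close>, \<open>ab\<close>. Exchanging \<open>\<eta>\<close> and \<open>\<eta>'\<close> only renames the letters of the rewritten
  word, so \<open>palindromic\<close> does not depend on their order; it is meaningful only for
  \<open>\<eta> \<noteq> \<eta>'\<close>.\<close>

fun basic_generator :: "etype \<Rightarrow> word" where
  "basic_generator E01 = gen_a"
| "basic_generator E10 = gen_b"
| "basic_generator E11 = gen_a \<otimes>\<^bsub>F2\<^esub> gen_b"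

definition palindromic :: "etype \<Rightarrow> etype \<Rightarrow> word \<Rightarrow> bool" where
  "palindromic \<eta> \<eta>' u \<longleftrightarrow>
     (\<exists>w. reduced w \<and> subst_word (basic_generator \<eta>) (basic_generator \<eta>') w = u \<and> rev w = w)"

definition palindromic_pair :: "etype \<Rightarrow> etype \<Rightarrow> word \<times> word \<Rightarrow> bool" where
  "palindromic_pair \<eta> \<eta>' p \<longleftrightarrow> palindromic \<eta> \<eta>' (fst p) \<and> palindromic \<eta> \<eta>' (snd p)"

end

theory Submission
  imports Defs
begin

text \<open>Let \<open>rev\<close> be the anti-automorphism of the free group that fixes both letters. For every
  basis \<open>(u, v)\<close> there is a single \<open>g\<close> with \<open>rev u = g u g\<inverse>\<close> and \<open>rev v = g v g\<inverse>\<close>: this property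
  is inherited along Nielsen moves and simultaneous conjugation, and these lead to a pair of
  letters. Since the center is trivial, \<open>g\<close> is a palindrome, and so are \<open>g u\<close> and \<open>g v\<close>. A
  palindrome \<open>g = p (rev p)\<close> of even length makes the conjugates of \<open>u\<close> and \<open>v\<close> by \<open>rev p\<close>
  palindromic; if \<open>g\<close> has odd length and \<open>u\<close> too, \<open>g u\<close> does this for \<open>u\<close>, and if \<open>u\<close> and \<open>v\<close> have
  the classes of the two letters mod 2, odd length of \<open>g\<close> is impossible because even palindromes
  have even exponent sums. The basic pairs are handled by a change of basis.

  Palindromes are cyclically reduced, so conjugate ones are rotations of each other, and two
  palindromic rotations of a word of odd length coincide; this is uniqueness. Positivity is
  automatic: with respect to the original letters, a word \<open>u\<close> that is palindromic for
  \<open>(a, ab)\<close> or \<open>(b, ab)\<close> satisfies \<open>u = l (rev u) l\<inverse>\<close> for \<open>l = a\<close> or \<open>l = b\<inverse>\<close>, which forces it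
  to be cyclically reduced and hence a rotation of every positive conjugate.\<close>

interpretation F2: group F2
  by (rule group_F2)

abbreviation mul :: "word \<Rightarrow> word \<Rightarrow> word"  (infixl "\<odot>" 70) where
  "x \<odot> y \<equiv> x \<otimes>\<^bsub>F2\<^esub> y"

abbreviation ginv :: "word \<Rightarrow> word" where
  "ginv x \<equiv> inv\<^bsub>F2\<^esub> x"

subsection \<open>Calculating with reduced words\<close>

lemma carrier_F2 [simp]: "x \<in> carrier F2 \<longleftrightarrow> reduced x"
  by (simp add: F2_def)

lemma mult_F2: "x \<odot> y = reduce (x @ y)"
  by (simp add: F2_def)

lemma one_F2 [simp]: "\<one>\<^bsub>F2\<^esub> = []"
  by (simp add: F2_def)

lemma reduced_mult [simp]: "reduced (x \<odot> y)"
  by (simp add: mult_F2)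

lemma reduced_inv [simp]: "reduced x \<Longrightarrow> reduced (ginv x)"
  using F2.inv_closed[of x] by simp

lemma mult_Nil [simp]: "reduced x \<Longrightarrow> [] \<odot> x = x" "reduced x \<Longrightarrow> x \<odot> [] = x"
  by (simp_all add: mult_F2 reduce_reduced)

lemma inv_Nil [simp]: "ginv [] = []"
  using F2.inv_one by (simp add: one_F2)

lemma mult_inv [simp]: "reduced x \<Longrightarrow> x \<odot> ginv x = []" "reduced x \<Longrightarrow> ginv x \<odot> x = []"
  using F2.r_inv[of x] F2.l_inv[of x] by (simp_all add: one_F2)

lemma mult_inv_cancel [simp]:
  assumes "reduced x" "reduced y"
  shows "x \<odot> (ginv x \<odot> y) = y" "ginv x \<odot> (x \<odot> y) = y"
  using assms by (simp_all flip: F2.m_assoc)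

lemmas F2_simps = F2.m_assoc F2.inv_mult_group

lemma inv_letter_eq_iff: "inv_letter x = y \<longleftrightarrow> x = inv_letter y"
  by (cases x; cases y) (auto simp: inv_letter_def)

lemma inv_letter_neq [simp]: "inv_letter x \<noteq> x" "x \<noteq> inv_letter x"
  by (cases x; simp add: inv_letter_def)+

lemma reduced_append:
  "reduced (v @ w) \<longleftrightarrow>
     reduced v \<and> reduced w \<and> (v = [] \<or> w = [] \<or> hd w \<noteq> inv_letter (last v))"
  by (auto simp: reduced_def successively_append_iff)

lemma reduced_rev [simp]: "reduced (rev w) \<longleftrightarrow> reduced w"
proof -
  have "x \<noteq> inv_letter y \<longleftrightarrow> y \<noteq> inv_letter x" for x y
    by (metis inv_letter_inv_letter)
  then show ?thesis by (simp add: reduced_def)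
qed

lemma reduced_map_inv [simp]: "reduced (map inv_letter w) \<longleftrightarrow> reduced w"
  by (induction w) (auto simp: reduced_Cons hd_map inv_letter_eq_iff)

lemma inv_F2: "reduced w \<Longrightarrow> ginv w = rev (map inv_letter w)"
  by (rule F2.inv_equality) (simp_all add: mult_F2 one_F2 reduce_inverse)

lemma length_inv [simp]: "reduced w \<Longrightarrow> length (ginv w) = length w"
  by (simp add: inv_F2)

lemma inv_eq_Nil [simp]: "reduced w \<Longrightarrow> ginv w = [] \<longleftrightarrow> w = []"
  by (simp add: inv_F2)

lemma inv_append: "reduced (v @ w) \<Longrightarrow> ginv (v @ w) = ginv w @ ginv v"
  by (simp add: inv_F2 reduced_append)

lemma mult_append: "reduced (v @ w) \<Longrightarrow> v \<odot> w = v @ w"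
  by (simp add: mult_F2 reduce_reduced)

lemma mult_Cons: "x # w = [x] \<odot> w" if "reduced (x # w)"
  using mult_append[of "[x]" w] that by simp

lemma reduce_cancel: "reduce (v @ x # inv_letter x # w) = reduce (v @ w)"
proof -
  have "reduce (x # inv_letter x # w) = reduce w"
    using push_cancel[OF reduced_reduce, of x w] by (simp add: reduce_def)
  then show ?thesis by (metis reduce_append)
qed

text \<open>A letter appended at the right end cancels exactly when the same letter pushed at the
  left end of the reversed word does. This makes \<open>rev\<close> an anti-automorphism of
  \<open>F2\<close> in \<open>rev_mult\<close>.\<close>

lemma reduce_rev: "reduce (rev w) = rev (reduce w)"
proof (induction w)
  case (Cons x w)
  have eq: "reduce (x # w) = push x (reduce w)" by (simp add: reduce_def)
  have "reduce (rev (x # w)) = reduce (rev (reduce w) @ [x])"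
    by (metis Cons reduce_append_reduce(1) rev.simps(2))
  also have "\<dots> = rev (push x (reduce w))"
  proof (cases "\<exists>ys. reduce w = inv_letter x # ys")
    case True
    then obtain ys where ys: "reduce w = inv_letter x # ys" by blast
    then have "reduced ys" by (metis reduced_Cons reduced_reduce)
    then show ?thesis
      using ys reduce_cancel[of "rev ys" "inv_letter x" "[]"] by (simp add: reduce_reduced)
  next
    case False
    then have "push x (reduce w) = x # reduce w" by (cases "reduce w") auto
    moreover from this have "reduced (x # reduce w)" using eq by (metis reduced_reduce)
    ultimately show ?thesis
      by (metis reduce_reduced reduced_rev rev.simps(2))
  qed
  finally show ?case by (simp add: eq)
qed (simp add: reduce_def)

lemma rev_mult: "rev (x \<odot> y) = rev y \<odot> rev x"
  by (simp add: mult_F2 flip: reduce_rev)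

lemma rev_inv: "reduced x \<Longrightarrow> rev (ginv x) = ginv (rev x)"
  by (simp add: inv_F2 rev_map)

text \<open>Let \<open>m\<close> be a letter on the other generator than the first letter
  \<open>l\<close> of \<open>g\<close>. Then \<open>m g\<close> involves no cancellation and has
  length one more than \<open>g\<close>, so \<open>g m\<close> cannot cancel either. Comparing the
  first letters of \<open>m g\<close> and \<open>g m\<close> gives \<open>m = l\<close>, a
  contradiction.\<close>

lemma center_F2:
  assumes "reduced g" and comm: "\<And>x. reduced x \<Longrightarrow> g \<odot> x = x \<odot> g"
  shows "g = []"
proof (rule ccontr)
  assume "g \<noteq> []"
  then obtain l r where g: "g = l # r" by (cases g) auto
  obtain m :: "letter \<times> bool" where m: "fst m \<noteq> fst l"
    by (metis fst_conv letter.distinct(1))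
  then have "m \<noteq> l" "l \<noteq> inv_letter m" by (auto simp: inv_letter_def)
  then have 1: "[m] \<odot> g = m # g"
    using assms(1) g by (subst mult_append) (auto simp: reduced_Cons)
  have 2: "g \<odot> [m] = m # g" using comm[of "[m]"] 1 by (simp add: reduced_Cons)
  have "g \<odot> [m] = g @ [m]"
  proof (cases "last g = inv_letter m")
    case True
    then obtain s where s: "g = s @ [inv_letter m]"
      using \<open>g \<noteq> []\<close> by (metis append_butlast_last_id)
    then have "reduced s" using assms(1) by (simp add: reduced_append)
    then have "g \<odot> [m] = s"
      using s reduce_cancel[of s "inv_letter m" "[]"] by (simp add: mult_F2 reduce_reduced)
    then show ?thesis using 2 s by simp
  next
    case False
    then show ?thesis
      using assms(1) by (intro mult_append) (auto simp: reduced_append reduced_Cons inv_letter_eq_iff)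
  qed
  then show False using 2 g \<open>m \<noteq> l\<close> by simp
qed

subsection \<open>Conjugation and rotation\<close>

text \<open>The condition on the two ends is preserved by \<open>rotate1\<close>, so only the
  rotations by 0 and 1 have to be inspected.\<close>

lemma cyclically_shortest_iff:
  "cyclically_shortest w \<longleftrightarrow> reduced w \<and> (w = [] \<or> hd w \<noteq> inv_letter (last w))"
    (is "_ \<longleftrightarrow> ?P w")
proof
  assume "cyclically_shortest w"
  then have "reduced (rotate 0 w)" "reduced (rotate 1 w)"
    unfolding cyclically_shortest_def by blast+
  then show "?P w"
    by (cases w) (auto simp: reduced_append split: if_splits)
next
  have step: "?P (rotate1 v)" if "?P v" for v
    using that by (cases v) (auto simp: reduced_append reduced_Cons split: if_splits)
  assume P: "?P w"
  have "?P (rotate n w)" for n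
  proof (induction n)
    case (Suc n)
    show ?case using step[OF Suc] by simp
  qed (use P in simp)
  then show "cyclically_shortest w"
    unfolding cyclically_shortest_def by blast
qed

lemma cyclically_shortest_rotate:
  "cyclically_shortest w \<Longrightarrow> cyclically_shortest (rotate n w)"
  by (simp add: cyclically_shortest_def rotate_rotate)

text \<open>Induction on the conjugator, peeling off its last letter \<open>x\<close>. If
  \<open>x\<close> cancels at either end of \<open>w\<close>, conjugation by \<open>x\<close> merely
  rotates \<open>w\<close>. If it cancels at neither, \<open>g w g^-1\<close> is reduced as written,
  and its two ends are inverse letters, so it is not cyclically shortest.\<close>

lemma cyclically_shortest_conjugate_rotate:
  assumes "cyclically_shortest w" "cyclically_shortest (g \<odot> w \<odot> ginv g)" "reduced g"
  shows "\<exists>n. g \<odot> w \<odot> ginv g = rotate n w"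
  using assms
proof (induction "length g" arbitrary: g w)
  case 0
  then show ?case
    by (auto simp: cyclically_shortest_iff intro!: exI[of _ 0])
next
  case (Suc k)
  have red: "reduced w" using Suc.prems by (simp add: cyclically_shortest_iff)
  obtain g' x where g: "g = g' @ [x]" using Suc.hyps(2) by (cases g rule: rev_cases) auto
  have red': "reduced g'" "reduced [x]" using Suc.prems g by (auto simp: reduced_append)
  have gm: "g = g' \<odot> [x]" using mult_append Suc.prems(3) g by simp
  have ix: "ginv [x] = [inv_letter x]" by (simp add: inv_F2 red')
  have conj: "g \<odot> w \<odot> ginv g = g' \<odot> ([x] \<odot> w \<odot> ginv [x]) \<odot> ginv g'"
    unfolding gm using red red' by (simp add: F2_simps)
  have IH: ?case if eq: "[x] \<odot> w \<odot> ginv [x] = rotate m w" for m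
  proof -
    have "\<exists>n. g' \<odot> rotate m w \<odot> ginv g' = rotate n (rotate m w)"
    proof (rule Suc.hyps(1))
      show "k = length g'" using Suc.hyps(2) g by simp
      show "cyclically_shortest (rotate m w)" by (rule cyclically_shortest_rotate) fact
      show "cyclically_shortest (g' \<odot> rotate m w \<odot> ginv g')"
        using Suc.prems(2) unfolding conj eq .
    qed (fact red')
    then show ?thesis unfolding conj eq by (auto simp: rotate_rotate)
  qed
  consider "w = []" | r where "w = inv_letter x # r" | r where "w = r @ [x]"
    | "w \<noteq> []" "hd w \<noteq> inv_letter x" "last w \<noteq> x"
    using append_butlast_last_id[of w] list.collapse[of w] by metis
  then show ?case
  proof cases
    case 1
    then show ?thesis using Suc.prems by simp
  next
    case 2
    have r: "reduced r" "reduced (r @ [inv_letter x])"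
      using red cyclically_shortest_rotate[OF Suc.prems(1), of 1] 2
      by (auto simp: reduced_Cons cyclically_shortest_iff)
    have "w = ginv [x] \<odot> r" using mult_Cons red 2 ix by simp
    then have "[x] \<odot> w \<odot> ginv [x] = r \<odot> ginv [x]"
      using r red' by simp
    also have "\<dots> = rotate 1 w" using r 2 by (simp add: ix mult_append)
    finally show ?thesis by (rule IH)
  next
    case 3
    have "rotate (length r) w = x # r" using 3 by (simp add: rotate_append)
    then have r: "reduced r" "reduced (x # r)"
      using red cyclically_shortest_rotate[OF Suc.prems(1), of "length r"] 3
      by (auto simp: reduced_append cyclically_shortest_iff)
    have "w = r \<odot> [x]" using mult_append red 3 by simp
    then have "[x] \<odot> w \<odot> ginv [x] = [x] \<odot> r"
      using r red' by (simp add: F2_simps)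
    also have "\<dots> = rotate (length r) w"
      using r 3 by (simp add: mult_Cons rotate_append)
    finally show ?thesis by (rule IH)
  next
    case 4
    have "ginv g = inv_letter x # ginv g'" using g Suc.prems(3) by (simp add: inv_append ix)
    then have "reduced (w @ ginv g)"
      using reduced_inv[OF Suc.prems(3)] red 4 by (auto simp: reduced_append inv_letter_eq_iff)
    moreover have "last g = x" using g by simp
    ultimately have "reduced (g @ w @ ginv g)"
      using Suc.prems(3) 4 by (simp add: reduced_append[of g])
    then have "g \<odot> w \<odot> ginv g = g @ w @ ginv g"
      by (metis append.assoc mult_append reduced_append)
    moreover have "hd (g @ w @ ginv g) = inv_letter (last (g @ w @ ginv g))"
      using g Suc.prems(3) by (simp add: inv_F2 hd_append last_rev hd_map)
    ultimately show ?thesis using Suc.prems(2) g by (simp add: cyclically_shortest_iff)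
  qed
qed

section \<open>Palindromes within a conjugacy class\<close>

lemma palindrome_cyclically_shortest:
  assumes "reduced w" "rev w = w"
  shows "cyclically_shortest w"
  using assms by (metis cyclically_shortest_iff hd_rev inv_letter_neq(2))

text \<open>Reversing turns rotation by \<open>k\<close> into rotation by \<open>-k\<close>, so two
  palindromic rotations give invariance under rotation by \<open>2 k\<close>. For odd length, 2 is
  invertible modulo the length.\<close>

lemma odd_palindrome_rotate:
  assumes "rev w = w" "rev (rotate k w) = rotate k w" "odd (length w)"
  shows "rotate k w = w"
proof -
  let ?n = "length w"
  have per: "rotate (j * m) w = w" if "rotate j w = w" for j m
  proof (induction m)
    case (Suc m)
    have "rotate (j * Suc m) w = rotate j (rotate (j * m) w)"
      by (simp add: rotate_rotate)
    then show ?case using Suc that by simp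
  qed simp
  have "rotate k w = rev (rotate k w)" using assms by simp
  also have "\<dots> = rotate (?n - k mod ?n) w"
    using assms(1) by (metis rotate_rev rev_rev_ident)
  finally have "rotate (k mod ?n) (rotate k w) = rotate (k mod ?n + (?n - k mod ?n)) w"
    by (simp only: rotate_rotate)
  then have "rotate k (rotate k w) = rotate (k mod ?n + (?n - k mod ?n)) w"
    by (subst rotate_conv_mod) simp
  also have "k mod ?n + (?n - k mod ?n) = ?n"
    using assms(3) mod_less_divisor[of ?n k] by (cases w) auto
  finally have "rotate (k + k) w = w" by (simp add: rotate_rotate)
  \<comment> \<open>The factor \<open>(?n + 1) / 2\<close> is the inverse of 2 modulo
    \<open>?n\<close>.\<close>
  then have "rotate ((k + k) * (Suc ?n div 2)) w = w" by (rule per)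
  moreover have "(k + k) * (Suc ?n div 2) = k + ?n * k"
    using assms(3) by (auto elim!: oddE simp: algebra_simps)
  moreover have "rotate (?n * k) w = w" by (rule rotate_id) simp
  ultimately show ?thesis by (metis rotate_rotate)
qed

lemma odd_palindrome_conjugate:
  assumes "reduced w" "reduced g" "rev w = w" "odd (length w)"
    and "rev (g \<odot> w \<odot> ginv g) = g \<odot> w \<odot> ginv g"
  shows "g \<odot> w \<odot> ginv g = w"
proof -
  obtain n where "g \<odot> w \<odot> ginv g = rotate n w"
    using cyclically_shortest_conjugate_rotate[of w g] palindrome_cyclically_shortest assms
    by (metis reduced_mult)
  then show ?thesis using odd_palindrome_rotate[of w n] assms by simp
qed

subsection \<open>Substitution homomorphisms\<close>

definition letter_val :: "word \<Rightarrow> word \<Rightarrow> letter \<times> bool \<Rightarrow> word" where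
  "letter_val x y l =
     (let z = if fst l = La then x else y in if snd l then z else ginv z)"

lemma subst_word_Nil [simp]: "subst_word x y [] = []"
  by (simp add: subst_word_def)

lemma subst_word_Cons: "subst_word x y (l # w) = letter_val x y l \<odot> subst_word x y w"
  by (cases l) (simp add: subst_word_def letter_val_def)

lemma reduced_letter_val [simp]:
  "reduced x \<Longrightarrow> reduced y \<Longrightarrow> reduced (letter_val x y l)"
  by (simp add: letter_val_def Let_def)

lemma reduced_subst_word [simp]: "reduced (subst_word x y w)"
  by (cases w) (simp_all add: subst_word_Cons)

lemma letter_val_inv_letter:
  "reduced x \<Longrightarrow> reduced y \<Longrightarrow> letter_val x y (inv_letter l) = ginv (letter_val x y l)"
  by (simp add: letter_val_def inv_letter_def Let_def)

lemma subst_word_single: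
  "reduced x \<Longrightarrow> reduced y \<Longrightarrow> subst_word x y [l] = letter_val x y l"
  by (simp add: subst_word_Cons)

lemma subst_word_gens [simp]:
  "reduced x \<Longrightarrow> reduced y \<Longrightarrow> subst_word x y gen_a = x"
  "reduced x \<Longrightarrow> reduced y \<Longrightarrow> subst_word x y gen_b = y"
  by (simp_all add: gen_a_def gen_b_def subst_word_single letter_val_def)

lemma reduced_gens [simp]: "reduced gen_a" "reduced gen_b"
  by (simp_all add: gen_a_def gen_b_def reduced_Cons)

lemma subst_word_append:
  assumes "reduced x" "reduced y"
  shows "subst_word x y (v @ w) = subst_word x y v \<odot> subst_word x y w"
  using assms by (induction v) (simp_all add: subst_word_Cons F2_simps)

lemma subst_word_reduce:
  assumes "reduced x" "reduced y"
  shows "subst_word x y (reduce w) = subst_word x y w"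
proof (induction w)
  case (Cons l w)
  have push: "subst_word x y (push l v) = letter_val x y l \<odot> subst_word x y v" for v
    using assms by (cases v) (simp_all add: subst_word_Cons letter_val_inv_letter)
  have "reduce (l # w) = push l (reduce w)" by (simp add: reduce_def)
  then show ?case using Cons by (simp add: push subst_word_Cons)
qed (simp add: reduce_def)

lemma subst_word_mult:
  assumes "reduced x" "reduced y"
  shows "subst_word x y (v \<odot> w) = subst_word x y v \<odot> subst_word x y w"
  using assms by (simp add: mult_F2[of v w] subst_word_reduce subst_word_append)

lemma subst_word_inv:
  assumes "reduced x" "reduced y" "reduced w"
  shows "subst_word x y (ginv w) = ginv (subst_word x y w)"
  using assms by (intro F2.inv_equality[symmetric]) (simp_all flip: subst_word_mult)

lemma subst_word_comp:
  assumes "reduced x" "reduced y" "reduced x'" "reduced y'"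
  shows "subst_word x y (subst_word x' y' w) =
    subst_word (subst_word x y x') (subst_word x y y') w"
proof (induction w)
  case (Cons l w)
  have "subst_word x y (letter_val x' y' l) =
      letter_val (subst_word x y x') (subst_word x y y') l"
    using assms by (simp add: letter_val_def Let_def subst_word_inv)
  then show ?case using Cons assms by (simp add: subst_word_Cons subst_word_mult)
qed simp

lemma subst_word_id: "reduced w \<Longrightarrow> subst_word gen_a gen_b w = w"
proof (induction w)
  case (Cons l w)
  have "letter_val gen_a gen_b l = [l]"
    by (cases l; cases "fst l"; cases "snd l")
      (auto simp: letter_val_def gen_a_def gen_b_def inv_F2 reduced_Cons inv_letter_def)
  then show ?case using Cons by (simp add: subst_word_Cons reduced_Cons mult_append)
qed simp

lemma subgroup_subst_range:
  assumes "reduced x" "reduced y"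
  shows "subgroup {subst_word x y w |w. reduced w} F2"
proof (rule F2.subgroupI)
  show "{subst_word x y w |w. reduced w} \<noteq> {}" using reduced_Nil by blast
next
  fix a assume "a \<in> {subst_word x y w |w. reduced w}"
  then obtain w where "reduced w" "a = subst_word x y w" by blast
  then show "ginv a \<in> {subst_word x y w |w. reduced w}"
    using assms by (auto intro!: exI[of _ "ginv w"] simp: subst_word_inv)
next
  fix a b
  assume "a \<in> {subst_word x y w |w. reduced w}" "b \<in> {subst_word x y w |w. reduced w}"
  then obtain v w where "a = subst_word x y v" "b = subst_word x y w" by blast
  then show "a \<odot> b \<in> {subst_word x y w |w. reduced w}"
    using assms by (auto intro!: exI[of _ "v \<odot> w"] simp: subst_word_mult)
qed auto

lemma subst_word_in_subgroup:
  assumes "subgroup H F2" "x \<in> H" "y \<in> H"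
  shows "subst_word x y w \<in> H"
proof (induction w)
  case (Cons l w)
  have "letter_val x y l \<in> H"
    using assms by (auto simp: letter_val_def Let_def subgroup.m_inv_closed)
  then show ?case using Cons assms(1) by (simp add: subst_word_Cons subgroup.m_closed)
qed (use subgroup.one_closed[OF assms(1)] in simp)

subsection \<open>Nielsen moves\<close>

text \<open>Formulated through subgroups, so that passing to a new pair only requires recovering the
  old elements inside a subgroup containing the new ones.\<close>

definition generating :: "word \<Rightarrow> word \<Rightarrow> bool" where
  "generating u v \<longleftrightarrow> (\<forall>H. subgroup H F2 \<longrightarrow> u \<in> H \<longrightarrow> v \<in> H \<longrightarrow> (\<forall>x. reduced x \<longrightarrow> x \<in> H))"

lemma generatingD:
  "generating u v \<Longrightarrow> subgroup H F2 \<Longrightarrow> u \<in> H \<Longrightarrow> v \<in> H \<Longrightarrow> reduced x \<Longrightarrow> x \<in> H"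
  unfolding generating_def by blast

definition rev_conjugate :: "word \<Rightarrow> word \<Rightarrow> bool" where
  "rev_conjugate u v \<longleftrightarrow>
     (\<exists>g. reduced g \<and> rev u = g \<odot> u \<odot> ginv g \<and> rev v = g \<odot> v \<odot> ginv g)"

text \<open>The two implications run in opposite directions: generation is carried down to shorter
  pairs, and \<open>rev_conjugate\<close> is pulled back from them. Chains of elementary moves and
  simultaneous conjugations are all instances.\<close>

definition nielsen_move :: "word \<Rightarrow> word \<Rightarrow> word \<Rightarrow> word \<Rightarrow> bool" where
  "nielsen_move u v u' v' \<longleftrightarrow>
     reduced u' \<and> reduced v' \<and> (generating u v \<longrightarrow> generating u' v') \<and>
     (rev_conjugate u' v' \<longrightarrow> rev_conjugate u v)"

lemma nielsen_trans:
  "nielsen_move u v u' v' \<Longrightarrow> nielsen_move u' v' u'' v'' \<Longrightarrow> nielsen_move u v u'' v''"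
  by (auto simp: nielsen_move_def)

lemma nielsen_refl: "reduced u \<Longrightarrow> reduced v \<Longrightarrow> nielsen_move u v u v"
  by (simp add: nielsen_move_def)

lemma nielsen_swap: "reduced u \<Longrightarrow> reduced v \<Longrightarrow> nielsen_move u v v u"
  by (auto simp: nielsen_move_def generating_def rev_conjugate_def)

lemma nielsen_inv:
  assumes "reduced u" "reduced v"
  shows "nielsen_move u v (ginv u) v"
  unfolding nielsen_move_def
proof (intro conjI impI)
  assume g: "generating u v"
  show "generating (ginv u) v"
    unfolding generating_def
  proof (intro allI impI)
    fix H x assume H: "subgroup H F2" "ginv u \<in> H" "v \<in> H" "reduced x"
    have "u \<in> H" using subgroup.m_inv_closed[OF H(1,2)] assms by simp
    then show "x \<in> H" using generatingD[OF g] H by blast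
  qed
next
  assume "rev_conjugate (ginv u) v"
  then obtain g where g: "reduced g" "rev (ginv u) = g \<odot> ginv u \<odot> ginv g"
      "rev v = g \<odot> v \<odot> ginv g"
    unfolding rev_conjugate_def by blast
  have "ginv (rev u) = ginv (g \<odot> u \<odot> ginv g)"
    using g assms by (simp add: rev_inv F2_simps)
  then have "rev u = g \<odot> u \<odot> ginv g"
    using assms by (metis F2.inv_inv carrier_F2 reduced_mult reduced_rev)
  then show "rev_conjugate u v" using g unfolding rev_conjugate_def by blast
qed (use assms in simp_all)

text \<open>Since \<open>rev\<close> exchanges the factors of \<open>u v\<close>, the conjugator has
  to be corrected from \<open>g\<close> to \<open>g v^-1\<close>. The correction leaves the equation
  for \<open>v\<close> intact because \<open>v\<close> commutes with itself.\<close>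

lemma nielsen_mult:
  assumes "reduced u" "reduced v"
  shows "nielsen_move u v (u \<odot> v) v"
  unfolding nielsen_move_def
proof (intro conjI impI)
  assume g: "generating u v"
  show "generating (u \<odot> v) v"
    unfolding generating_def
  proof (intro allI impI)
    fix H x assume H: "subgroup H F2" "u \<odot> v \<in> H" "v \<in> H" "reduced x"
    have "(u \<odot> v) \<odot> ginv v \<in> H"
      using H by (simp add: subgroup.m_closed subgroup.m_inv_closed)
    then have "u \<in> H" using assms by (simp add: F2_simps)
    then show "x \<in> H" using generatingD[OF g] H by blast
  qed
next
  assume "rev_conjugate (u \<odot> v) v"
  then obtain g where g: "reduced g" "rev v \<odot> rev u = g \<odot> (u \<odot> v) \<odot> ginv g"
      "rev v = g \<odot> v \<odot> ginv g"
    unfolding rev_conjugate_def rev_mult by blast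
  let ?h = "g \<odot> ginv v"
  have "rev u = ginv (rev v) \<odot> (rev v \<odot> rev u)" using assms by simp
  also have "\<dots> = ?h \<odot> u \<odot> ginv ?h"
    unfolding g(2) unfolding g(3) using assms g(1) by (simp add: F2_simps)
  finally have "rev u = ?h \<odot> u \<odot> ginv ?h" .
  moreover have "rev v = ?h \<odot> v \<odot> ginv ?h"
    unfolding g(3) using assms g(1) by (simp add: F2_simps)
  ultimately show "rev_conjugate u v"
    unfolding rev_conjugate_def using reduced_mult by blast
qed (use assms in simp_all)

lemma subgroup_conj_preimage:
  assumes "subgroup H F2" "reduced h"
  shows "subgroup {x. reduced x \<and> h \<odot> x \<odot> ginv h \<in> H} F2"
proof (rule F2.subgroupI)
  show "{x. reduced x \<and> h \<odot> x \<odot> ginv h \<in> H} \<noteq> {}"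
    using assms subgroup.one_closed[OF assms(1)] by (auto intro!: exI[of _ "[]"])
next
  fix a assume "a \<in> {x. reduced x \<and> h \<odot> x \<odot> ginv h \<in> H}"
  moreover from this have "ginv (h \<odot> a \<odot> ginv h) = h \<odot> ginv a \<odot> ginv h"
    using assms by (simp add: F2_simps)
  ultimately show "ginv a \<in> {x. reduced x \<and> h \<odot> x \<odot> ginv h \<in> H}"
    using subgroup.m_inv_closed[OF assms(1), of "h \<odot> a \<odot> ginv h"] by simp
next
  fix a b
  assume "a \<in> {x. reduced x \<and> h \<odot> x \<odot> ginv h \<in> H}"
     and "b \<in> {x. reduced x \<and> h \<odot> x \<odot> ginv h \<in> H}"
  moreover from this
  have "h \<odot> a \<odot> ginv h \<odot> (h \<odot> b \<odot> ginv h) = h \<odot> (a \<odot> b) \<odot> ginv h"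
    using assms by (simp add: F2_simps)
  ultimately show "a \<odot> b \<in> {x. reduced x \<and> h \<odot> x \<odot> ginv h \<in> H}"
    using subgroup.m_closed[OF assms(1), of "h \<odot> a \<odot> ginv h" "h \<odot> b \<odot> ginv h"] by simp
qed auto

lemma nielsen_conj:
  assumes "reduced u" "reduced v" "reduced h"
  shows "nielsen_move u v (h \<odot> u \<odot> ginv h) (h \<odot> v \<odot> ginv h)"
  unfolding nielsen_move_def
proof (intro conjI impI)
  assume g: "generating u v"
  show "generating (h \<odot> u \<odot> ginv h) (h \<odot> v \<odot> ginv h)"
    unfolding generating_def
  proof (intro allI impI)
    fix H x assume H: "subgroup H F2" "h \<odot> u \<odot> ginv h \<in> H" "h \<odot> v \<odot> ginv h \<in> H" "reduced x"
    \<comment> \<open>The preimage of \<open>H\<close> under conjugation by \<open>h\<close> is a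
      subgroup containing \<open>u\<close> and \<open>v\<close>, hence everything.\<close>
    have "ginv h \<odot> x \<odot> h \<in> {x. reduced x \<and> h \<odot> x \<odot> ginv h \<in> H}"
      by (rule generatingD[OF g subgroup_conj_preimage[OF H(1) assms(3)]])
        (use H assms in simp_all)
    moreover have "h \<odot> (ginv h \<odot> x \<odot> h) \<odot> ginv h = x"
      using assms H(4) by (simp add: F2_simps)
    ultimately show "x \<in> H" by simp
  qed
next
  assume "rev_conjugate (h \<odot> u \<odot> ginv h) (h \<odot> v \<odot> ginv h)"
  then obtain g where g: "reduced g"
      "rev (h \<odot> u \<odot> ginv h) = g \<odot> (h \<odot> u \<odot> ginv h) \<odot> ginv g"
      "rev (h \<odot> v \<odot> ginv h) = g \<odot> (h \<odot> v \<odot> ginv h) \<odot> ginv g"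
    unfolding rev_conjugate_def by blast
  \<comment> \<open>Obtained by solving \<open>rev (h w h^-1) = (rev h)^-1 (rev w) (rev h)\<close>
    for \<open>rev w\<close>.\<close>
  let ?k = "rev h \<odot> g \<odot> h"
  have "rev w = ?k \<odot> w \<odot> ginv ?k"
    if "reduced w" "rev (h \<odot> w \<odot> ginv h) = g \<odot> (h \<odot> w \<odot> ginv h) \<odot> ginv g" for w
  proof -
    have "rev w = rev h \<odot> rev (h \<odot> w \<odot> ginv h) \<odot> ginv (rev h)"
      using assms that(1) by (simp add: rev_mult rev_inv F2_simps)
    also have "\<dots> = ?k \<odot> w \<odot> ginv ?k"
      unfolding that(2) using assms that(1) g(1) by (simp add: F2_simps)
    finally show ?thesis .
  qed
  then show "rev_conjugate u v"
    using g assms unfolding rev_conjugate_def by (metis reduced_mult)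
qed (use assms in simp_all)

text \<open>Lets the shortening argument treat both orders and all signs of the two generators at
  once.\<close>

lemma nielsen_letter_val:
  assumes "reduced u" "reduced v" "fst l \<noteq> fst m"
  shows "nielsen_move u v (letter_val u v l) (letter_val u v m)"
proof -
  have sgn: "nielsen_move x y (if s then x else ginv x) y"
    if "reduced x" "reduced y" for x y s
    using that by (simp add: nielsen_refl nielsen_inv)
  have sgn2: "nielsen_move x y (if s then x else ginv x) (if t then y else ginv y)"
    if "reduced x" "reduced y" for x y s t
  proof -
    have "nielsen_move x y y (if s then x else ginv x)"
      using nielsen_trans[OF sgn[OF that] nielsen_swap] that by simp
    then have "nielsen_move x y (if t then y else ginv y) (if s then x else ginv x)"
      using nielsen_trans[OF _ sgn] that by simp
    then show ?thesis using nielsen_trans[OF _ nielsen_swap] that by simp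
  qed
  show ?thesis
  proof (cases "fst l")
    case La
    then have "fst m \<noteq> La" using assms(3) by simp
    then show ?thesis
      using La sgn2[OF assms(1,2), of "snd l" "snd m"] by (simp add: letter_val_def)
  next
    case Lb
    then have "fst m = La" using assms(3) by (cases "fst m") auto
    then show ?thesis
      using Lb nielsen_trans[OF nielsen_swap[OF assms(1,2)] sgn2[OF assms(2,1), of "snd l" "snd m"]]
      by (simp add: letter_val_def)
  qed
qed

text \<open>Multiplying in the swapped pair gives \<open>v u\<close>, and conjugation by
  \<open>u\<close> turns this into \<open>u v\<close> while fixing \<open>u\<close>.\<close>

lemma nielsen_mult_left:
  assumes "reduced u" "reduced v"
  shows "nielsen_move u v u (u \<odot> v)"
proof -
  have "nielsen_move v u (v \<odot> u) u" using assms by (rule nielsen_mult[rotated])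
  moreover have "nielsen_move (v \<odot> u) u (u \<odot> v) u"
    using nielsen_conj[of "v \<odot> u" u u] assms by (simp add: F2_simps)
  ultimately show ?thesis
    using nielsen_trans nielsen_swap assms by (meson reduced_mult)
qed

section \<open>Centralizers and nontriviality for generating pairs\<close>

lemma subgroup_centralizer:
  assumes "reduced g"
  shows "subgroup {x. reduced x \<and> x \<odot> g = g \<odot> x} F2"
proof (rule F2.subgroupI)
  show "{x. reduced x \<and> x \<odot> g = g \<odot> x} \<noteq> {}" using assms by blast
next
  fix a assume "a \<in> {x. reduced x \<and> x \<odot> g = g \<odot> x}"
  then have a: "reduced a" "a \<odot> g = g \<odot> a" by auto
  have "ginv a \<odot> g = ginv a \<odot> (g \<odot> a) \<odot> ginv a" using a(1) assms by (simp add: F2_simps)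
  also have "\<dots> = g \<odot> ginv a" unfolding a(2)[symmetric] using a(1) assms by simp
  finally show "ginv a \<in> {x. reduced x \<and> x \<odot> g = g \<odot> x}" using a by simp
next
  fix a b
  assume "a \<in> {x. reduced x \<and> x \<odot> g = g \<odot> x}" "b \<in> {x. reduced x \<and> x \<odot> g = g \<odot> x}"
  then have *: "reduced a" "reduced b" "a \<odot> g = g \<odot> a" "b \<odot> g = g \<odot> b" by auto
  have "a \<odot> b \<odot> g = a \<odot> (b \<odot> g)" using *(1,2) assms by (simp add: F2_simps)
  also have "\<dots> = a \<odot> g \<odot> b" unfolding *(4) using *(1,2) assms by (simp add: F2_simps)
  also have "\<dots> = g \<odot> (a \<odot> b)" unfolding *(3) using *(1,2) assms by (simp add: F2_simps)
  finally show "a \<odot> b \<in> {x. reduced x \<and> x \<odot> g = g \<odot> x}" by simp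
qed auto

lemma generating_commute_trivial:
  assumes "generating u v" "reduced u" "reduced v" "reduced g"
    and "u \<odot> g = g \<odot> u" "v \<odot> g = g \<odot> v"
  shows "g = []"
proof (rule center_F2)
  fix x assume "reduced x"
  have "x \<in> {x. reduced x \<and> x \<odot> g = g \<odot> x}"
    by (rule generatingD[OF assms(1) subgroup_centralizer[OF assms(4)]])
      (use assms \<open>reduced x\<close> in simp_all)
  then show "g \<odot> x = x \<odot> g" by simp
qed fact

text \<open>If one element were trivial, the other would commute with both, hence be trivial as
  well, and the trivial subgroup would be everything.\<close>

lemma generating_nontrivial:
  assumes "generating u v" "reduced u" "reduced v"
  shows "u \<noteq> []" "v \<noteq> []"
proof -
  have *: "y \<noteq> []" if "generating x y" "reduced x" for x y
  proof
    assume "y = []"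
    then have "x = []" using generating_commute_trivial[OF that(1), of x] that by simp
    moreover have "subgroup {[]} F2" using F2.triv_subgroup by simp
    ultimately have "gen_a \<in> {[]}" using generatingD[OF that(1), of "{[]}" gen_a] \<open>y = []\<close> by simp
    then show False by (simp add: gen_a_def)
  qed
  then show "v \<noteq> []" using assms by blast
  have "generating v u" using assms(1) unfolding generating_def by blast
  then show "u \<noteq> []" using * assms by blast
qed

subsection \<open>Nielsen reduction\<close>

text \<open>The number of letters that each factor loses in the product;
  \<open>cancel_decomp\<close> exhibits them.\<close>

definition cancel :: "word \<Rightarrow> word \<Rightarrow> nat" where
  "cancel x y = (length x + length y - length (x \<odot> y)) div 2"

lemma cancel_decomp:
  assumes "reduced x" "reduced y"
  shows "\<exists>p t r. x = p @ t \<and> y = ginv t @ r \<and> reduced (p @ r) \<and> x \<odot> y = p @ r \<and>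
    length t = cancel x y"
proof -
  have "\<exists>p t r. x = p @ t \<and> y = ginv t @ r \<and> reduced (p @ r)"
    using assms
  proof (induction x arbitrary: y rule: rev_induct)
    case Nil
    then show ?case by (auto intro!: exI[of _ "[]"])
  next
    case (snoc s x)
    show ?case
    proof (cases "\<exists>y'. y = inv_letter s # y'")
      case True
      then obtain y' where y: "y = inv_letter s # y'" by blast
      then obtain p t r where IH: "x = p @ t" "y' = ginv t @ r" "reduced (p @ r)"
        using snoc.IH[of y'] snoc.prems by (auto simp: reduced_append reduced_Cons)
      then have "reduced (t @ [s])" using snoc.prems by (simp add: reduced_append)
      then have "ginv (t @ [s]) = inv_letter s # ginv t"
        by (simp add: inv_F2 reduced_append)
      then show ?thesis using IH y by (intro exI[of _ p] exI[of _ "t @ [s]"] exI[of _ r]) simp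
    next
      case False
      then have "reduced ((x @ [s]) @ y)"
        using snoc.prems by (cases y) (simp_all add: reduced_append[of "x @ [s]"] del: append_assoc)
      then show ?thesis by (intro exI[of _ "x @ [s]"] exI[of _ "[]"] exI[of _ y]) simp
    qed
  qed
  then obtain p t r where *: "x = p @ t" "y = ginv t @ r" "reduced (p @ r)" by blast
  then have red: "reduced p" "reduced t" "reduced r" using assms by (auto simp: reduced_append)
  have "x = p \<odot> t" "y = ginv t \<odot> r" using * assms by (simp_all add: mult_append)
  then have xy: "x \<odot> y = p @ r" using red *(3) by (simp add: F2_simps mult_append)
  then have "length t = cancel x y" using * red by (simp add: cancel_def)
  then show ?thesis using * xy by blast
qed

lemma length_mult_cancel:
  assumes "reduced x" "reduced y"
  shows "length (x \<odot> y) + 2 * cancel x y = length x + length y"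
proof -
  obtain p t r where *: "x = p @ t" "y = ginv t @ r" "x \<odot> y = p @ r" "length t = cancel x y"
    using cancel_decomp[OF assms] by blast
  moreover have "reduced t" using *(1) assms(1) by (simp add: reduced_append)
  ultimately have "length x = length p + length t" "length y = length t + length r"
    "length (x \<odot> y) = length p + length r" by simp_all
  then show ?thesis using *(4) by simp
qed

lemma length_mult_le: "reduced x \<Longrightarrow> reduced y \<Longrightarrow> length (x \<odot> y) \<le> length x + length y"
  using length_mult_cancel[of x y] by linarith

lemma reduced_inv_append_self: "reduced t \<Longrightarrow> reduced (ginv t @ t) \<Longrightarrow> t = []"
  by (cases t) (auto simp: reduced_append reduced_Cons inv_F2)

text \<open>If at least half of \<open>u\<close> cancelled against a second copy, each letter in the
  first half would be the inverse of its mirror image. At the middle this gives a letter equal to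
  its own inverse (odd length) or two adjacent inverse letters (even length).\<close>

lemma cancel_self:
  assumes "reduced u" "u \<noteq> []"
  shows "2 * cancel u u < length u"
proof (rule ccontr)
  assume ge: "\<not> 2 * cancel u u < length u"
  obtain p t r where *: "u = p @ t" "u = ginv t @ r" "length t = cancel u u"
    using cancel_decomp[OF assms(1) assms(1)] by blast
  have t: "reduced t" using *(1) assms(1) by (simp add: reduced_append)
  let ?n = "length u" and ?k = "length t"
  have k: "?n \<le> 2 * ?k" "?k \<le> ?n"
    using ge *(3) arg_cong[OF *(1), of length] by simp_all
  have n: "?n > 0" using assms(2) by simp
  have inv: "u ! i = inv_letter (u ! (?n - 1 - i))" if "i < ?k" for i
  proof -
    have "u ! i = ginv t ! i" using that t by (subst *(2)) (simp add: nth_append)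
    also have "\<dots> = inv_letter (t ! (?k - 1 - i))"
      using that t by (simp add: inv_F2 rev_nth)
    also have "t ! (?k - 1 - i) = u ! (length p + (?k - 1 - i))" by (subst *(1)) simp
    also have "length p + (?k - 1 - i) = ?n - 1 - i"
      using that *(1) by simp
    finally show ?thesis .
  qed
  let ?i = "(?n - 1) div 2"
  have i: "?i < ?k" using k n by linarith
  show False
  proof (cases "odd ?n")
    case True
    then have "?n - 1 - ?i = ?i" by (auto elim!: oddE)
    then show False using inv[OF i] by simp
  next
    case False
    then obtain b where "?n = 2 * b" by blast
    moreover from this obtain c where "b = Suc c" using n by (cases b) auto
    ultimately have eq: "?n - 1 - ?i = Suc ?i" "Suc ?i < ?n" by simp_all
    have "u ! Suc ?i \<noteq> inv_letter (u ! ?i)"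
      using assms(1) eq(2) unfolding reduced_def by (simp add: successively_conv_nth)
    then show False using inv[OF i] eq(1) by simp
  qed
qed

text \<open>A Nielsen condition: in a reduced product of three signed generators, the neighbours do
  not consume the middle factor. Repetitions are allowed, so the case \<open>l = m = n\<close>
  forces both generators to be nonempty.\<close>

definition nielsen_reduced :: "word \<Rightarrow> word \<Rightarrow> bool" where
  "nielsen_reduced u v \<longleftrightarrow> (\<forall>l m n. m \<noteq> inv_letter l \<longrightarrow> n \<noteq> inv_letter m \<longrightarrow>
     cancel (letter_val u v l) (letter_val u v m) + cancel (letter_val u v m) (letter_val u v n)
       < length (letter_val u v m))"

text \<open>In a substituted word some part of the first factor is never cancelled, and
  every later factor leaves at least one letter behind.\<close>

lemma nielsen_reduced_decomp:
  assumes "reduced u" "reduced v" "nielsen_reduced u v" "reduced (l # w)"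
  shows "\<exists>p t s. letter_val u v l = p @ t \<and> subst_word u v (l # w) = p @ s \<and> p \<noteq> [] \<and>
    length w \<le> length s \<and>
    length t = (if w = [] then 0 else cancel (letter_val u v l) (letter_val u v (hd w)))"
  using assms(4)
proof (induction w arbitrary: l)
  case Nil
  have "length (letter_val u v l) > 0"
    using assms(3) unfolding nielsen_reduced_def by (metis inv_letter_neq(2) gr_zeroI not_less_zero)
  then show ?case using assms by (auto simp: subst_word_single)
next
  case (Cons m w)
  let ?l = "letter_val u v l" and ?m = "letter_val u v m"
  have red: "reduced ?l" "reduced ?m" using assms by simp_all
  have lm: "m \<noteq> inv_letter l" and w: "reduced (m # w)" using Cons.prems by (auto simp: reduced_Cons)
  obtain p' t' s' where IH: "?m = p' @ t'" "subst_word u v (m # w) = p' @ s'"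
      "length w \<le> length s'"
      "length t' = (if w = [] then 0 else cancel ?m (letter_val u v (hd w)))"
    using Cons.IH[OF w] by blast
  obtain p t r where d: "?l = p @ t" "?m = ginv t @ r" "reduced (p @ r)" "length t = cancel ?l ?m"
    using cancel_decomp[OF red] by blast
  have redt: "reduced p" "reduced t" using red(1) unfolding d(1) by (auto simp: reduced_append)
  have "length t + cancel ?m (letter_val u v n) < length ?m" if "n \<noteq> inv_letter m" for n
    using assms(3) lm that unfolding nielsen_reduced_def d(4) by blast
  \<comment> \<open>For empty \<open>w\<close> the word \<open>t'\<close> is empty and any
    admissible third letter serves, here \<open>m\<close>; otherwise the third letter is
    \<open>hd w\<close>.\<close>
  from this[of m] this[of "hd w"] have "length t + length t' < length ?m"
    using IH(4) w by (auto simp: reduced_Cons)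
  then have lt: "length t < length p'" using IH(1) by simp
  \<comment> \<open>The part of the factor of \<open>m\<close> that survives cancellation on both
    sides.\<close>
  define y where "y = drop (length t) p'"
  have y: "p' = ginv t @ y" "y \<noteq> []"
  proof -
    have "take (length t) p' = take (length t) ?m" using lt by (subst IH(1)) simp
    also have "\<dots> = ginv t" using redt by (subst d(2)) simp
    finally show "p' = ginv t @ y" unfolding y_def by (metis append_take_drop_id)
    show "y \<noteq> []" using lt by (simp add: y_def)
  qed
  have r: "r = y @ t'" using IH(1) d(2) y(1) by simp
  have "reduced (ginv t @ (y @ s'))"
    using reduced_subst_word[of u v "m # w"] unfolding IH(2) y(1) by simp
  then have ys: "subst_word u v (m # w) = ginv t \<odot> (y @ s')" "reduced (y @ s')"
    using IH(2) y(1) by (auto simp: mult_append reduced_append)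
  have "reduced (p @ y @ s')"
    using d(3) ys(2) y(2) unfolding r by (simp add: reduced_append[of p])
  moreover have "subst_word u v (l # m # w) = ?l \<odot> (ginv t \<odot> (y @ s'))"
    using ys(1) subst_word_Cons[of u v l "m # w"] by simp
  moreover have "?l = p \<odot> t" using red(1) unfolding d(1) by (simp add: mult_append)
  ultimately have eq: "subst_word u v (l # m # w) = p @ y @ s'"
    using redt ys(2) by (simp add: F2_simps mult_append)
  \<comment> \<open>The triple \<open>l, l, m\<close> shows that \<open>m\<close> cannot absorb all
    of the first factor.\<close>
  have "cancel ?l ?l + length t < length ?l"
    using assms(3) lm unfolding nielsen_reduced_def d(4) by (metis inv_letter_neq(2))
  then have "p \<noteq> []" using d(1) by auto
  moreover have "length (m # w) \<le> length (y @ s')" using IH(3) y(2) by (cases y) auto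
  ultimately show ?case using d(1,4) eq
    by (intro exI[of _ p] exI[of _ t] exI[of _ "y @ s'"]) simp
qed

lemma nielsen_reduced_length:
  assumes "reduced u" "reduced v" "nielsen_reduced u v" "reduced w"
  shows "length w \<le> length (subst_word u v w)"
proof (cases w)
  case (Cons l w')
  then obtain p s where "subst_word u v w = p @ s" "p \<noteq> []" "length w' \<le> length s"
    using nielsen_reduced_decomp[OF assms(1-3), of l w'] assms(4) by blast
  then show ?thesis using Cons by (cases p) auto
qed simp

lemma generatingE:
  assumes "generating u v" "reduced u" "reduced v" "reduced x"
  obtains w where "reduced w" "x = subst_word u v w"
proof -
  have "x \<in> {subst_word u v w |w. reduced w}"
  proof (rule generatingD[OF assms(1) subgroup_subst_range[OF assms(2,3)]])
    show "u \<in> {subst_word u v w |w. reduced w}" "v \<in> {subst_word u v w |w. reduced w}"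
      using assms subst_word_gens[of u v] reduced_gens by (metis (mono_tags, lifting) mem_Collect_eq)+
  qed fact
  then show thesis using that by blast
qed

text \<open>A single letter can only come from a substituted word of length one, so \<open>a\<close>
  and \<open>b\<close> are themselves among the two generators and their inverses. They stem from
  different generators because they are neither equal nor inverse.\<close>

lemma nielsen_reduced_generating:
  assumes "reduced u" "reduced v" "nielsen_reduced u v" "generating u v"
  shows "length u = 1" "length v = 1"
proof -
  have *: "\<exists>l. letter_val u v l = x" if x: "reduced x" "length x = 1" for x
  proof -
    obtain w where w: "reduced w" "x = subst_word u v w"
      using generatingE[OF assms(4,1,2) x(1)] by metis
    then have "length w \<le> 1" using nielsen_reduced_length[OF assms(1-3), of w] x by simp
    moreover have "w \<noteq> []" using w x by auto
    ultimately obtain l where "w = [l]" by (cases w) auto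
    then show ?thesis using w(2) assms by (intro exI[of _ l]) (simp add: subst_word_single)
  qed
  obtain l where l: "letter_val u v l = gen_a" using *[of gen_a] by (auto simp: gen_a_def reduced_Cons)
  obtain m where m: "letter_val u v m = gen_b" using *[of gen_b] by (auto simp: gen_b_def reduced_Cons)
  have "fst l \<noteq> fst m"
  proof
    assume "fst l = fst m"
    then have "l = m \<or> l = inv_letter m" by (cases l; cases m) (auto simp: inv_letter_def)
    then have "gen_a = gen_b \<or> gen_a = ginv gen_b"
      using l m assms by (auto simp: letter_val_inv_letter)
    then show False by (auto simp: gen_a_def gen_b_def inv_F2 reduced_Cons inv_letter_def)
  qed
  moreover have "length (letter_val u v l) = 1" "length (letter_val u v m) = 1"
    unfolding l m by (simp_all add: gen_a_def gen_b_def)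
  ultimately show "length u = 1" "length v = 1"
    using assms by (cases "fst l"; cases "fst m"; auto simp: letter_val_def Let_def split: if_splits)+
qed

text \<open>Take a triple \<open>x, y, z\<close> violating \<open>nielsen_reduced\<close>. If no
  product of two different generators is shorter than one of its factors, cancellation between
  different generators takes at most half of each, and self-cancellation takes strictly less. So the
  violation is an equality: \<open>x\<close> and \<open>z\<close> each cancel exactly half of
  \<open>y\<close>, and both lie over the other generator.\<close>

lemma nielsen_shorten:
  assumes "reduced u" "reduced v" "u \<noteq> []" "v \<noteq> []" "\<not> nielsen_reduced u v"
  shows "\<exists>u' v'. nielsen_move u v u' v' \<and> length u' + length v' < length u + length v"
proof -
  let ?f = "letter_val u v"
  obtain l m n where lmn: "m \<noteq> inv_letter l" "n \<noteq> inv_letter m"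
      "length (?f m) \<le> cancel (?f l) (?f m) + cancel (?f m) (?f n)"
    using assms(5) unfolding nielsen_reduced_def by (auto simp: not_less)
  have red: "reduced (?f k)" and ne: "?f k \<noteq> []" for k
    using assms by (auto simp: letter_val_def Let_def)
  have eq_or: "j = k" if "fst j = fst k" "k \<noteq> inv_letter j" for j k :: "letter \<times> bool"
    using that by (cases j; cases k) (auto simp: inv_letter_def)
  have self: "2 * cancel (?f k) (?f k) < length (?f k)" for k
    by (rule cancel_self[OF red ne])
  have len: "length (?f j) + length (?f k) = length u + length v" if "fst j \<noteq> fst k" for j k
    using that assms(1,2)
    by (cases "fst j"; cases "fst k") (auto simp: letter_val_def Let_def)
  have shortL: ?thesis if "fst j \<noteq> fst k" "length (?f j \<odot> ?f k) < length (?f j)" for j k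
  proof -
    have "nielsen_move u v (?f j \<odot> ?f k) (?f k)"
      using nielsen_trans[OF nielsen_letter_val nielsen_mult] that(1) assms red by simp
    then show ?thesis using that len[OF that(1)] by force
  qed
  have shortR: ?thesis if "fst j \<noteq> fst k" "length (?f j \<odot> ?f k) < length (?f k)" for j k
  proof -
    have "nielsen_move u v (?f j) (?f j \<odot> ?f k)"
      using nielsen_trans[OF nielsen_letter_val nielsen_mult_left] that(1) assms red by simp
    then show ?thesis using that len[OF that(1)] by force
  qed
  have cl: "length (?f j \<odot> ?f k) + 2 * cancel (?f j) (?f k) = length (?f j) + length (?f k)" for j k
    by (rule length_mult_cancel[OF red red])
  show ?thesis
  proof (rule ccontr)
    assume contra: "\<not> ?thesis"
    have half: "2 * cancel (?f j) (?f k) \<le> length (?f j)" "2 * cancel (?f j) (?f k) \<le> length (?f k)"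
      if "fst j \<noteq> fst k" for j k
    proof -
      have "\<not> length (?f j \<odot> ?f k) < length (?f j)" "\<not> length (?f j \<odot> ?f k) < length (?f k)"
        using shortL[OF that] shortR[OF that] contra by blast+
      then show "2 * cancel (?f j) (?f k) \<le> length (?f j)" "2 * cancel (?f j) (?f k) \<le> length (?f k)"
        using cl[of j k] by linarith+
    qed
    have lm: "fst l \<noteq> fst m"
    proof
      assume "fst l = fst m"
      then have "l = m" using eq_or lmn(1) by blast
      moreover have "2 * cancel (?f m) (?f n) \<le> length (?f m)"
        using half(1)[of m n] self[of m] eq_or[of m n] lmn(2) by fastforce
      ultimately show False using self[of m] lmn(3) by simp
    qed
    have mn: "fst m \<noteq> fst n"
    proof
      assume "fst m = fst n"
      then have "m = n" using eq_or lmn(2) by blast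
      then show False using half(2)[OF lm] self[of m] lmn(3) by simp
    qed
    have k: "2 * cancel (?f l) (?f m) = length (?f m)" "2 * cancel (?f m) (?f n) = length (?f m)"
      using half(2)[OF lm] half(1)[OF mn] lmn(3) by linarith+
    let ?x = "?f l" and ?y = "?f m" and ?z = "?f n"
    obtain q t1 r1 where a: "?x = q @ t1" "?y = ginv t1 @ r1" "length t1 = cancel ?x ?y"
      using cancel_decomp[OF red red] by blast
    obtain p2 t2 r2 where b: "?y = p2 @ t2" "?z = ginv t2 @ r2" "length t2 = cancel ?y ?z"
      using cancel_decomp[OF red red] by blast
    have redt: "reduced t1" "reduced t2"
      using red[of l] red[of m] unfolding a(1) b(1) by (auto simp: reduced_append)
    have "length p2 = length (ginv t1)"
      using arg_cong[OF b(1), of length] k a(3) b(3) redt by simp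
    \<comment> \<open>The half of \<open>y\<close> cancelled by \<open>x\<close> and the half
      cancelled by \<open>z\<close> fit together exactly.\<close>
    then have y: "?y = ginv t1 @ t2" using a(2) b(1) by (metis append_eq_append_conv)
    have tlen: "length t1 = length t2" using a(3) b(3) k by simp
    have "fst l = fst n" using lm mn by (cases "fst l"; cases "fst m"; cases "fst n") auto
    then consider "n = l" | "n = inv_letter l" using eq_or by blast
    then show False
    proof cases
      case 1
      txt \<open>Here \<open>x = t2\<inverse> s t1\<close> and \<open>y = t1\<inverse> t2\<close>, so \<open>y x\<close> is no shorter than \<open>x\<close>, but
        conjugating \<open>(y, y x)\<close> by \<open>t1\<close> gives \<open>(t2 t1\<inverse>, s)\<close>.\<close>
      have "length t1 + length t2 \<le> length ?x"
        using half(1)[OF lm] k a(3) b(3) by linarith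
      moreover have x2: "?x = ginv t2 @ r2" using b(2) 1 by simp
      ultimately obtain s where x: "?x = ginv t2 @ s @ t1"
      proof -
        assume le: "length t1 + length t2 \<le> length ?x"
          and that: "\<And>s. ?x = ginv t2 @ s @ t1 \<Longrightarrow> thesis"
        have "length (ginv t2) \<le> length q" using le arg_cong[OF a(1), of length] redt by simp
        then have "\<exists>s. q = ginv t2 @ s"
          using a(1) x2 by (metis append_eq_append_conv_if append_take_drop_id)
        then show thesis using that a(1) by auto
      qed
      have "reduced (ginv t2 @ s @ t1)" using red[of l] unfolding x .
      then have s: "reduced s" "reduced (s @ t1)" by (auto simp: reduced_append)
      have xm: "?x = ginv t2 \<odot> (s \<odot> t1)"
        using red[of l] s(2) unfolding x by (simp add: mult_append)
      have ym: "?y = ginv t1 \<odot> t2" using red[of m] unfolding y by (simp add: mult_append)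
      let ?u' = "t1 \<odot> ?y \<odot> ginv t1" and ?v' = "t1 \<odot> (?y \<odot> ?x) \<odot> ginv t1"
      have "nielsen_move u v ?y (?y \<odot> ?x)"
        using nielsen_trans[OF nielsen_letter_val nielsen_mult_left] lm assms red by metis
      then have mv: "nielsen_move u v ?u' ?v'"
        by (rule nielsen_trans[OF _ nielsen_conj]) (use red redt in simp_all)
      have "?u' = t2 \<odot> ginv t1" unfolding ym using redt by (simp add: F2_simps)
      then have "length ?u' \<le> length ?y"
        using length_mult_le[of t2 "ginv t1"] redt y by simp
      moreover have "?v' = s" unfolding ym xm using redt s by (simp add: F2_simps)
      moreover have "length s < length ?x"
        using arg_cong[OF x, of length] tlen arg_cong[OF y, of length] ne[of m] redt
        by (cases t1) auto
      ultimately show False using mv len[OF lm] contra by force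
    next
      case 2
      \<comment> \<open>Now \<open>z\<close> begins with the inverse of \<open>t1\<close> as well as
        that of \<open>t2\<close>, so \<open>y = t1^-1 t1\<close> is written without cancellation
        and must be empty.\<close>
      have "?z = ginv ?x" using 2 assms by (simp add: letter_val_inv_letter)
      also have "\<dots> = ginv t1 @ ginv q" using red[of l] unfolding a(1) by (simp add: inv_append)
      finally have "ginv t2 = ginv t1"
        using b(2) tlen redt by (metis append_eq_append_conv length_inv)
      then have "t2 = t1" using redt by (metis F2.inv_inv carrier_F2)
      then have "t1 = []" using reduced_inv_append_self[OF redt(1)] red[of m] y by simp
      then show False using y \<open>t2 = t1\<close> ne[of m] by simp
    qed
  qed
qed

text \<open>Descent on the total length. It ends at a pair of single letters, which
  \<open>rev\<close> fixes, so the trivial conjugator works there and is pulled back along the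
  moves.\<close>

lemma generating_rev_conjugate:
  assumes "reduced u" "reduced v" "generating u v"
  shows "rev_conjugate u v"
  using assms
proof (induction "length u + length v" arbitrary: u v rule: less_induct)
  case less
  note ne = generating_nontrivial[OF less.prems(3,1,2)]
  show ?case
  proof (cases "nielsen_reduced u v")
    case True
    then have "length u = 1" "length v = 1"
      using nielsen_reduced_generating less.prems by blast+
    then have "rev u = u" "rev v = v" by (auto simp: length_Suc_conv)
    then show ?thesis using less.prems unfolding rev_conjugate_def
      by (intro exI[of _ "[]"]) simp
  next
    case False
    then obtain u' v' where "nielsen_move u v u' v'" "length u' + length v' < length u + length v"
      using nielsen_shorten less.prems ne by blast
    then show ?thesis using less unfolding nielsen_move_def by blast
  qed
qed

subsection \<open>Exponent sums\<close>

lemma exponent_sum_Nil [simp]: "exponent_sum l [] = 0"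
  by (simp add: exponent_sum_def)

lemma exponent_sum_Cons:
  "exponent_sum l (x # w) =
     (if fst x = l then (if snd x then 1 else - 1) else 0) + exponent_sum l w"
  by (simp add: exponent_sum_def)

lemma exponent_sum_append: "exponent_sum l (v @ w) = exponent_sum l v + exponent_sum l w"
  by (simp add: exponent_sum_def)

lemma exponent_sum_rev: "exponent_sum l (rev w) = exponent_sum l w"
  by (induction w) (simp_all add: exponent_sum_append exponent_sum_Cons)

lemma exponent_sum_reduce: "exponent_sum l (reduce w) = exponent_sum l w"
proof (induction w)
  case (Cons x w)
  have "exponent_sum l (push x v) = exponent_sum l (x # v)" for v
    by (cases v) (auto simp: exponent_sum_Cons inv_letter_def)
  moreover have "reduce (x # w) = push x (reduce w)" by (simp add: reduce_def)
  ultimately show ?case using Cons by (simp add: exponent_sum_Cons)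
qed (simp add: reduce_def)

lemma exponent_sum_mult: "exponent_sum l (v \<odot> w) = exponent_sum l v + exponent_sum l w"
  by (simp add: mult_F2 exponent_sum_reduce exponent_sum_append)

lemma exponent_sum_inv: "reduced w \<Longrightarrow> exponent_sum l (ginv w) = - exponent_sum l w"
  using exponent_sum_mult[of l "ginv w" w] by simp

lemma exponent_sum_subst_word:
  assumes "reduced x" "reduced y"
  shows "exponent_sum l (subst_word x y w) =
    exponent_sum La w * exponent_sum l x + exponent_sum Lb w * exponent_sum l y"
proof (induction w)
  case (Cons m w)
  show ?case
    using Cons assms
    by (cases "fst m")
      (auto simp: subst_word_Cons exponent_sum_mult exponent_sum_Cons letter_val_def Let_def
        exponent_sum_inv algebra_simps)
qed simp

lemma even_length_iff: "even (length w) \<longleftrightarrow> even (exponent_sum La w + exponent_sum Lb w)"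
proof (induction w)
  case (Cons x w)
  then show ?case by (cases "fst x"; cases "snd x") (auto simp: exponent_sum_Cons)
qed simp

lemma even_length_mult:
  "reduced x \<Longrightarrow> reduced y \<Longrightarrow> even (length (x \<odot> y)) \<longleftrightarrow> even (length x + length y)"
  using length_mult_cancel[of x y] by (metis even_add even_mult_iff even_numeral)

lemma even_palindrome:
  assumes "rev w = w" "even (length w)"
  shows "\<exists>p. w = p @ rev p"
proof -
  obtain n where n: "length w = 2 * n" using assms(2) by blast
  have "w = take n w @ drop n w" by simp
  also have "drop n w = rev (take n w)"
    using assms(1) n rev_take[of n w] by simp
  finally show ?thesis by blast
qed

lemma even_palindrome_exponent_sum:
  assumes "rev w = w" "even (length w)"
  shows "even (exponent_sum l w)"
proof -
  obtain p where "w = p @ rev p" using even_palindrome[OF assms] by blast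
  then show ?thesis by (simp add: exponent_sum_append exponent_sum_rev)
qed

lemma has_type_conj:
  "reduced u \<Longrightarrow> reduced g \<Longrightarrow> has_type (g \<odot> u \<odot> ginv g) \<eta> \<longleftrightarrow> has_type u \<eta>"
  by (cases \<eta>) (simp_all add: exponent_sum_mult exponent_sum_inv)

subsection \<open>Palindromic conjugates of generating pairs\<close>

text \<open>With \<open>g = p (rev p)\<close> take \<open>h = rev p\<close>: reversing
  \<open>h x h^-1\<close> gives \<open>p^-1 (rev x) p\<close>, and inserting
  \<open>rev x = g x g^-1\<close> returns \<open>h x h^-1\<close>. As \<open>h\<close> depends only
  on \<open>g\<close>, it serves both members of a pair.\<close>

lemma palindromic_conjugator:
  assumes "reduced g" "rev g = g" "even (length g)"
  shows "\<exists>h. reduced h \<and> (\<forall>x. reduced x \<longrightarrow> rev x = g \<odot> x \<odot> ginv g \<longrightarrow>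
    rev (h \<odot> x \<odot> ginv h) = h \<odot> x \<odot> ginv h)"
proof -
  obtain p where p: "g = p @ rev p" using even_palindrome[OF assms(2,3)] by blast
  then have red: "reduced p" using assms(1) by (simp add: reduced_append)
  have g: "g = p \<odot> rev p" using p assms(1) by (simp add: mult_append)
  have "rev (rev p \<odot> x \<odot> ginv (rev p)) = rev p \<odot> x \<odot> ginv (rev p)"
    if "reduced x" and eq: "rev x = g \<odot> x \<odot> ginv g" for x
  proof -
    have "rev (rev p \<odot> x \<odot> ginv (rev p)) = ginv p \<odot> rev x \<odot> p"
      using that(1) red by (simp add: rev_mult F2_simps flip: rev_inv)
    then show ?thesis unfolding eq unfolding g using that(1) red by (simp add: F2_simps)
  qed
  then show ?thesis using red by (intro exI[of _ "rev p"]) simp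
qed

lemma generating_palindromic_conjugator:
  assumes "generating u v" "reduced u" "reduced v"
  shows "\<exists>g. reduced g \<and> rev u = g \<odot> u \<odot> ginv g \<and> rev v = g \<odot> v \<odot> ginv g \<and>
    rev g = g \<and> rev (g \<odot> u) = g \<odot> u \<and> rev (g \<odot> v) = g \<odot> v"
proof -
  obtain g where g: "reduced g" "rev u = g \<odot> u \<odot> ginv g" "rev v = g \<odot> v \<odot> ginv g"
    using generating_rev_conjugate[OF assms(2,3,1)] unfolding rev_conjugate_def by blast
  \<comment> \<open>Reversing \<open>rev x = g x g^-1\<close> yields a second conjugator
    \<open>rev g\<close> from \<open>x\<close> to \<open>rev x\<close>; \<open>?c\<close> measures
    the difference and centralizes \<open>u\<close> and \<open>v\<close>.\<close>
  let ?c = "ginv (rev g) \<odot> g"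
  have comm: "x \<odot> ?c = ?c \<odot> x" if "reduced x" "rev x = g \<odot> x \<odot> ginv g" for x
  proof -
    have "x = rev (g \<odot> x \<odot> ginv g)" using that(2) by (metis rev_rev_ident)
    also have "\<dots> = ginv (rev g) \<odot> rev x \<odot> rev g"
      using that(1) g(1) by (simp add: rev_mult rev_inv F2_simps)
    finally have "x \<odot> ?c = ginv (rev g) \<odot> rev x \<odot> rev g \<odot> ?c" by simp
    also have "\<dots> = ?c \<odot> x" unfolding that(2) using that(1) g(1) by (simp add: F2_simps)
    finally show ?thesis .
  qed
  have "?c = []"
    by (rule generating_commute_trivial[OF assms]) (use comm assms g in simp_all)
  then have "rev g \<odot> ?c = rev g" using g(1) by simp
  then have rg: "rev g = g" using g(1) by simp
  have "rev (g \<odot> x) = g \<odot> x" if "reduced x" "rev x = g \<odot> x \<odot> ginv g" for x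
    unfolding rev_mult rg that(2) using that(1) g(1) by (simp add: F2_simps)
  then show ?thesis using g rg assms by blast
qed

text \<open>Both \<open>g\<close> and \<open>g u\<close> conjugate \<open>u\<close> to
  \<open>rev u\<close>, both are palindromes, and for odd \<open>u\<close> exactly one of them has
  even length.\<close>

lemma generating_palindromic_conjugate:
  assumes "generating u v" "reduced u" "reduced v" "odd (length u)"
  shows "\<exists>h. reduced h \<and> rev (h \<odot> u \<odot> ginv h) = h \<odot> u \<odot> ginv h"
proof -
  obtain g where g: "reduced g" "rev u = g \<odot> u \<odot> ginv g" "rev g = g" "rev (g \<odot> u) = g \<odot> u"
    using generating_palindromic_conjugator[OF assms(1-3)] by blast
  show ?thesis
  proof (cases "even (length g)")
    case True
    then show ?thesis using palindromic_conjugator[of g] g assms(2) by blast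
  next
    case False
    then have "even (length (g \<odot> u))" using even_length_mult g(1) assms by simp
    moreover have "rev u = (g \<odot> u) \<odot> u \<odot> ginv (g \<odot> u)"
      using g(1,2) assms(2) by (simp add: F2_simps)
    ultimately show ?thesis
      using palindromic_conjugator[OF reduced_mult g(4)] assms(2) by blast
  qed
qed

text \<open>One conjugator must serve both words, so an odd \<open>g\<close> has to be excluded. It
  would make \<open>g u\<close> and \<open>g v\<close> even palindromes with even exponent sums in
  \<open>a\<close>, contradicting the parity hypothesis because \<open>g\<close> contributes
  twice.\<close>

lemma generating_palindromic_conjugate_pair:
  assumes "generating u v" "reduced u" "reduced v" "odd (length u)" "odd (length v)"
    and "odd (exponent_sum La u + exponent_sum La v)"
  shows "\<exists>h. reduced h \<and> rev (h \<odot> u \<odot> ginv h) = h \<odot> u \<odot> ginv h \<and>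
    rev (h \<odot> v \<odot> ginv h) = h \<odot> v \<odot> ginv h"
proof -
  obtain g where g: "reduced g" "rev u = g \<odot> u \<odot> ginv g" "rev v = g \<odot> v \<odot> ginv g"
      "rev g = g" "rev (g \<odot> u) = g \<odot> u" "rev (g \<odot> v) = g \<odot> v"
    using generating_palindromic_conjugator[OF assms(1-3)] by blast
  have "even (length g)"
  proof (rule ccontr)
    assume "odd (length g)"
    then have "even (length (g \<odot> u))" "even (length (g \<odot> v))"
      using even_length_mult g(1) assms by simp_all
    then have "even (exponent_sum La (g \<odot> u))" "even (exponent_sum La (g \<odot> v))"
      using even_palindrome_exponent_sum g(5,6) by blast+
    then show False using assms(6) by (simp add: exponent_sum_mult)
  qed
  then show ?thesis using palindromic_conjugator[of g] g assms(2,3) by blast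
qed

subsection \<open>Basic generator pairs\<close>

lemma reduced_basic_generator [simp]: "reduced (basic_generator \<eta>)"
  by (cases \<eta>) simp_all

lemma subst_word_inverse:
  assumes "reduced x" "reduced y" "reduced x'" "reduced y'"
    and "subst_word x y x' = gen_a" "subst_word x y y' = gen_b" "reduced w"
  shows "subst_word x y (subst_word x' y' w) = w"
  using assms by (simp add: subst_word_comp subst_word_id)

text \<open>The words \<open>x\<close> and \<open>y\<close> express \<open>a\<close> and
  \<open>b\<close> in the basic pair, so that substituting them is the inverse change of
  basis.\<close>

lemma basic_generator_inverse:
  assumes "\<eta> \<noteq> \<eta>'"
  obtains x y where "reduced x" "reduced y"
    "\<And>w. reduced w \<Longrightarrow> subst_word (basic_generator \<eta>) (basic_generator \<eta>') (subst_word x y w) = w"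
    "\<And>w. reduced w \<Longrightarrow> subst_word x y (subst_word (basic_generator \<eta>) (basic_generator \<eta>') w) = w"
proof -
  let ?X = "basic_generator \<eta>" and ?Y = "basic_generator \<eta>'"
  have "\<exists>x y. reduced x \<and> reduced y \<and> subst_word ?X ?Y x = gen_a \<and> subst_word ?X ?Y y = gen_b \<and>
      subst_word x y ?X = gen_a \<and> subst_word x y ?Y = gen_b"
  proof -
    note defs = subst_word_Cons letter_val_def gen_a_def gen_b_def mult_F2 reduce_def inv_F2
      inv_letter_def reduced_Cons
    consider "\<eta> = E01" "\<eta>' = E10" | "\<eta> = E10" "\<eta>' = E01" | "\<eta> = E01" "\<eta>' = E11"
      | "\<eta> = E11" "\<eta>' = E01" | "\<eta> = E10" "\<eta>' = E11" | "\<eta> = E11" "\<eta>' = E10"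
      using assms by (cases \<eta>; cases \<eta>') auto
    then show ?thesis
    proof cases
      case 1
      then show ?thesis by (intro exI[of _ gen_a] exI[of _ gen_b]) (simp add: defs)
    next
      case 2
      then show ?thesis by (intro exI[of _ gen_b] exI[of _ gen_a]) (simp add: defs)
    next
      case 3
      \<comment> \<open>In the basis \<open>(a, ab)\<close> the letter \<open>b\<close> is
        \<open>a^-1 (ab)\<close>; the remaining cases solve for \<open>a\<close> and
        \<open>b\<close> in the same way.\<close>
      then show ?thesis
        by (intro exI[of _ gen_a] exI[of _ "[(La, False), (Lb, True)]"]) (simp add: defs)
    next
      case 4
      then show ?thesis
        by (intro exI[of _ gen_b] exI[of _ "[(Lb, False), (La, True)]"]) (simp add: defs)
    next
      case 5
      then show ?thesis
        by (intro exI[of _ "[(Lb, True), (La, False)]"] exI[of _ gen_a]) (simp add: defs)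
    next
      case 6
      then show ?thesis
        by (intro exI[of _ "[(La, True), (Lb, False)]"] exI[of _ gen_b]) (simp add: defs)
    qed
  qed
  then obtain x y where xy: "reduced x" "reduced y" "subst_word ?X ?Y x = gen_a"
      "subst_word ?X ?Y y = gen_b" "subst_word x y ?X = gen_a" "subst_word x y ?Y = gen_b"
    by blast
  show thesis
    by (rule that[OF xy(1,2)]) (rule subst_word_inverse; use xy in simp)+
qed

text \<open>Modulo 2 the exponent vectors of a basic pair form a basis of the plane, so an element
  of type \<eta> or \<eta>' has a unit vector as its coordinates.\<close>

lemma basic_exponent_sum_parity:
  assumes "\<eta> \<noteq> \<eta>'" "has_type (subst_word (basic_generator \<eta>) (basic_generator \<eta>') w) \<theta>"
  shows "\<theta> = \<eta> \<Longrightarrow> odd (exponent_sum La w) \<and> even (exponent_sum Lb w)"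
    and "\<theta> = \<eta>' \<Longrightarrow> even (exponent_sum La w) \<and> odd (exponent_sum Lb w)"
proof -
  have gens: "exponent_sum La gen_a = 1" "exponent_sum Lb gen_a = 0"
    "exponent_sum La gen_b = 0" "exponent_sum Lb gen_b = 1"
    by (simp_all add: gen_a_def gen_b_def exponent_sum_Cons)
  show "\<theta> = \<eta> \<Longrightarrow> odd (exponent_sum La w) \<and> even (exponent_sum Lb w)"
    "\<theta> = \<eta>' \<Longrightarrow> even (exponent_sum La w) \<and> odd (exponent_sum Lb w)"
    using assms by (cases \<eta>; cases \<eta>'; auto simp: exponent_sum_subst_word exponent_sum_mult gens)+
qed

section \<open>Transfer to coordinates in a basic pair\<close>

lemma palindromic_iff:
  assumes "reduced u"
    and "\<And>w. reduced w \<Longrightarrow> subst_word (basic_generator \<eta>) (basic_generator \<eta>') (subst_word x y w) = w"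
    and "\<And>w. reduced w \<Longrightarrow> subst_word x y (subst_word (basic_generator \<eta>) (basic_generator \<eta>') w) = w"
  shows "palindromic \<eta> \<eta>' u \<longleftrightarrow> rev (subst_word x y u) = subst_word x y u"
  unfolding palindromic_def using assms by (metis reduced_subst_word)

text \<open>A surjective endomorphism preserves generation, since preimages of subgroups are
  subgroups.\<close>

lemma generating_subst_word:
  assumes "generating u v" "reduced u" "reduced v" "reduced x" "reduced y"
    and "\<And>w. reduced w \<Longrightarrow> \<exists>z. reduced z \<and> subst_word x y z = w"
  shows "generating (subst_word x y u) (subst_word x y v)"
  unfolding generating_def
proof (intro allI impI)
  fix H z
  assume H: "subgroup H F2" "subst_word x y u \<in> H" "subst_word x y v \<in> H" and "reduced z"
  have "subgroup {w. reduced w \<and> subst_word x y w \<in> H} F2"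
  proof (rule F2.subgroupI)
    show "{w. reduced w \<and> subst_word x y w \<in> H} \<noteq> {}" using H(2) assms(2) by blast
  qed (use H(1) assms(4,5) in \<open>auto simp: subst_word_inv subst_word_mult
        subgroup.m_closed subgroup.m_inv_closed\<close>)
  from generatingD[OF assms(1) this] have *: "subst_word x y w \<in> H" if "reduced w" for w
    using that H assms(2,3) by simp
  obtain w where "reduced w" "subst_word x y w = z" using assms(6) \<open>reduced z\<close> by blast
  then show "z \<in> H" using * by blast
qed

lemma palindromic_conjugate_exists:
  assumes "\<eta> \<noteq> \<eta>'" "generating u v" "reduced u" "reduced v" "has_type u \<eta>"
  shows "\<exists>g. reduced g \<and> palindromic \<eta> \<eta>' (g \<odot> u \<odot> ginv g)"
proof -
  let ?f = "subst_word (basic_generator \<eta>) (basic_generator \<eta>')"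
  obtain x y where xy: "reduced x" "reduced y"
      "\<And>w. reduced w \<Longrightarrow> ?f (subst_word x y w) = w" "\<And>w. reduced w \<Longrightarrow> subst_word x y (?f w) = w"
    using basic_generator_inverse[OF assms(1)] by metis
  let ?u = "subst_word x y u" and ?v = "subst_word x y v"
  have "generating ?u ?v"
    by (rule generating_subst_word) (use assms xy reduced_subst_word in blast)+
  moreover have "odd (length ?u)"
    using basic_exponent_sum_parity(1)[OF assms(1), of ?u \<eta>] assms xy by (simp add: even_length_iff)
  ultimately obtain h where h: "reduced h" "rev (h \<odot> ?u \<odot> ginv h) = h \<odot> ?u \<odot> ginv h"
    using generating_palindromic_conjugate reduced_subst_word by metis
  have "subst_word x y (?f h \<odot> u \<odot> ginv (?f h)) = h \<odot> ?u \<odot> ginv h"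
    using xy h(1) by (simp add: subst_word_mult subst_word_inv)
  then show ?thesis
    using h by (intro exI[of _ "?f h"]) (simp add: palindromic_iff[OF _ xy(3,4)])
qed

lemma palindromic_conjugate_pair_exists:
  assumes "\<eta> \<noteq> \<eta>'" "generating u v" "reduced u" "reduced v" "has_type u \<eta>" "has_type v \<eta>'"
  shows "\<exists>g. reduced g \<and> palindromic \<eta> \<eta>' (g \<odot> u \<odot> ginv g) \<and> palindromic \<eta> \<eta>' (g \<odot> v \<odot> ginv g)"
proof -
  let ?f = "subst_word (basic_generator \<eta>) (basic_generator \<eta>')"
  obtain x y where xy: "reduced x" "reduced y"
      "\<And>w. reduced w \<Longrightarrow> ?f (subst_word x y w) = w" "\<And>w. reduced w \<Longrightarrow> subst_word x y (?f w) = w"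
    using basic_generator_inverse[OF assms(1)] by metis
  let ?u = "subst_word x y u" and ?v = "subst_word x y v"
  have gen: "generating ?u ?v"
    by (rule generating_subst_word) (use assms xy reduced_subst_word in blast)+
  have par: "odd (exponent_sum La ?u)" "even (exponent_sum Lb ?u)"
      "even (exponent_sum La ?v)" "odd (exponent_sum Lb ?v)"
    using basic_exponent_sum_parity(1)[OF assms(1), of ?u \<eta>]
      basic_exponent_sum_parity(2)[OF assms(1), of ?v \<eta>'] assms xy by simp_all
  obtain h where h: "reduced h" "rev (h \<odot> ?u \<odot> ginv h) = h \<odot> ?u \<odot> ginv h"
      "rev (h \<odot> ?v \<odot> ginv h) = h \<odot> ?v \<odot> ginv h"
    using generating_palindromic_conjugate_pair[OF gen] par
    by (auto simp: even_length_iff)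
  have "subst_word x y (?f h \<odot> w \<odot> ginv (?f h)) = h \<odot> subst_word x y w \<odot> ginv h" for w
    using xy h(1) by (simp add: subst_word_mult subst_word_inv)
  then show ?thesis
    using h by (intro exI[of _ "?f h"]) (simp add: palindromic_iff[OF _ xy(3,4)])
qed

text \<open>In coordinates both conjugates are palindromes of odd length, and
  \<open>odd_palindrome_conjugate\<close> identifies them. Either type gives coordinates of opposite
  parity, hence odd length, so the lemma applies to both members of a pair.\<close>

lemma palindromic_conjugate_unique:
  assumes "\<eta> \<noteq> \<eta>'" "reduced u" "has_type u \<eta> \<or> has_type u \<eta>'"
    and "conjugate u u'" "palindromic \<eta> \<eta>' u'" "conjugate u u''" "palindromic \<eta> \<eta>' u''"
  shows "u' = u''"
proof -
  let ?f = "subst_word (basic_generator \<eta>) (basic_generator \<eta>')"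
  obtain x y where xy: "reduced x" "reduced y"
      "\<And>w. reduced w \<Longrightarrow> ?f (subst_word x y w) = w" "\<And>w. reduced w \<Longrightarrow> subst_word x y (?f w) = w"
    using basic_generator_inverse[OF assms(1)] by metis
  obtain g h where gh: "reduced g" "reduced h" "u' = g \<odot> u \<odot> ginv g" "u'' = h \<odot> u \<odot> ginv h"
    using assms(4,6) unfolding conjugate_def by auto
  then have red: "reduced u'" "reduced u''" by simp_all
  let ?w = "subst_word x y u'" and ?k = "subst_word x y (h \<odot> ginv g)"
  have "u'' = (h \<odot> ginv g) \<odot> u' \<odot> ginv (h \<odot> ginv g)"
    using gh assms(2) by (simp add: F2_simps)
  then have eq: "subst_word x y u'' = ?k \<odot> ?w \<odot> ginv ?k"
    using xy by (simp add: subst_word_mult subst_word_inv)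
  have "has_type (?f ?w) \<eta> \<or> has_type (?f ?w) \<eta>'"
    using assms(2,3) gh red xy(3) has_type_conj by simp
  then have "odd (length ?w)"
    using basic_exponent_sum_parity[OF assms(1), of ?w] by (auto simp: even_length_iff)
  moreover have "rev ?w = ?w" "rev (?k \<odot> ?w \<odot> ginv ?k) = ?k \<odot> ?w \<odot> ginv ?k"
    using assms(5,7) red by (simp_all add: palindromic_iff[OF _ xy(3,4)] flip: eq)
  ultimately have "subst_word x y u'' = ?w"
    unfolding eq by (intro odd_palindrome_conjugate) simp_all
  then show ?thesis using xy(3) red by metis
qed

subsection \<open>Positivity\<close>

text \<open>Reversal followed by conjugation with \<open>c\<close> is an anti-automorphism; once it
  fixes \<open>x\<close> and \<open>y\<close>, it acts on words in them by reversal.\<close>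

lemma rev_subst_word:
  assumes "reduced x" "reduced y" "reduced c"
    and "c \<odot> rev x \<odot> ginv c = x" "c \<odot> rev y \<odot> ginv c = y"
  shows "c \<odot> rev (subst_word x y w) \<odot> ginv c = subst_word x y (rev w)"
proof (induction w)
  case (Cons l w)
  have inv: "c \<odot> rev (ginv z) \<odot> ginv c = ginv z" if "reduced z" "c \<odot> rev z \<odot> ginv c = z" for z
  proof -
    have "c \<odot> rev (ginv z) \<odot> ginv c = ginv (c \<odot> rev z \<odot> ginv c)"
      using that(1) assms by (simp add: rev_inv F2_simps)
    then show ?thesis using that(2) by simp
  qed
  have l: "c \<odot> rev (letter_val x y l) \<odot> ginv c = letter_val x y l"
    using inv assms by (auto simp: letter_val_def Let_def)
  have "c \<odot> rev (subst_word x y (l # w)) \<odot> ginv c =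
      (c \<odot> rev (subst_word x y w) \<odot> ginv c) \<odot> (c \<odot> rev (letter_val x y l) \<odot> ginv c)"
    using assms by (simp add: subst_word_Cons rev_mult F2_simps)
  also have "\<dots> = subst_word x y (rev (l # w))"
    unfolding Cons l using assms by (simp add: subst_word_append subst_word_single)
  finally show ?case .
qed (use assms in simp)

text \<open>The hypothesis reads \<open>u l = l (rev u)\<close>. If \<open>u = t l^-1\<close>, it
  makes \<open>t\<close> a palindrome, which by reducedness neither ends nor begins with
  \<open>l\<close>. Otherwise \<open>u l\<close> is reduced and begins with \<open>l\<close>, so
  \<open>u\<close> begins with \<open>l\<close> but does not end with \<open>l^-1\<close>.\<close>

lemma twisted_palindrome_cyclically_shortest:
  assumes "reduced u" "[l] \<odot> rev u \<odot> ginv [l] = u"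
  shows "cyclically_shortest u"
proof -
  have rl: "reduced [l]" by (simp add: reduced_Cons)
  have "u \<odot> [l] = ([l] \<odot> rev u \<odot> ginv [l]) \<odot> [l]" using assms(2) by simp
  also have "\<dots> = [l] \<odot> rev u" using assms(1) rl by (simp add: F2_simps)
  finally have eq: "u \<odot> [l] = [l] \<odot> rev u" .
  consider "u = []" | t where "u = t @ [inv_letter l]" | "u \<noteq> []" "last u \<noteq> inv_letter l"
    using append_butlast_last_id by metis
  then show ?thesis
  proof cases
    case 1
    then show ?thesis by (simp add: cyclically_shortest_iff)
  next
    case 2
    have t: "reduced t" using assms(1) 2 by (simp add: reduced_append)
    have "u \<odot> [l] = t" "[l] \<odot> rev u = rev t"
      using reduce_cancel[of t "inv_letter l" "[]"] reduce_cancel[of "[]" l "rev t"] t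
      unfolding 2 by (simp_all add: mult_F2 reduce_reduced)
    then have "rev t = t" using eq by simp
    then have "t \<noteq> [] \<Longrightarrow> hd t \<noteq> l"
      using assms(1) unfolding 2
      by (auto simp: reduced_append inv_letter_eq_iff simp flip: hd_rev)
    then show ?thesis
      using assms(1) unfolding 2 by (auto simp: cyclically_shortest_iff hd_append)
  next
    case 3
    have r: "reduced (u @ [l])"
      using 3 assms(1) rl by (auto simp: reduced_append inv_letter_eq_iff)
    then have "reduced (rev (u @ [l]))" by (simp only: reduced_rev)
    then have "u @ [l] = l # rev u" using eq r by (simp add: mult_append)
    then have "hd (u @ [l]) = l" by simp
    then have "hd u = l" using 3(1) by simp
    then have "hd u \<noteq> inv_letter (last u)" using 3(2) by (metis inv_letter_inv_letter)
    then show ?thesis using assms(1) by (simp add: cyclically_shortest_iff)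
  qed
qed

lemma palindromic_cyclically_shortest:
  assumes "\<eta> \<noteq> \<eta>'" "palindromic \<eta> \<eta>' u"
  shows "cyclically_shortest u"
proof -
  let ?X = "basic_generator \<eta>" and ?Y = "basic_generator \<eta>'"
  obtain w where w: "u = subst_word ?X ?Y w" "rev w = w"
    using assms(2) unfolding palindromic_def by blast
  then have red: "reduced u" by simp
  \<comment> \<open>Reversal sends \<open>ab\<close> to \<open>ba\<close>; conjugation by
    \<open>a\<close> restores \<open>ab\<close> and fixes \<open>a\<close>, conjugation by
    \<open>b^-1\<close> restores it and fixes \<open>b\<close>.\<close>
  have "\<exists>c. (c = [] \<or> (\<exists>l. c = [l])) \<and> c \<odot> rev ?X \<odot> ginv c = ?X \<and> c \<odot> rev ?Y \<odot> ginv c = ?Y"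
  proof -
    note defs = gen_a_def gen_b_def mult_F2 reduce_def inv_F2 inv_letter_def reduced_Cons
    consider "{\<eta>, \<eta>'} = {E01, E10}" | "{\<eta>, \<eta>'} = {E01, E11}" | "{\<eta>, \<eta>'} = {E10, E11}"
      using assms(1) by (cases \<eta>; cases \<eta>') auto
    then show ?thesis
    proof cases
      case 1
      then show ?thesis by (intro exI[of _ "[]"]) (auto simp: defs doubleton_eq_iff)
    next
      case 2
      then show ?thesis by (intro exI[of _ "[(La, True)]"]) (auto simp: defs doubleton_eq_iff)
    next
      case 3
      then show ?thesis by (intro exI[of _ "[(Lb, False)]"]) (auto simp: defs doubleton_eq_iff)
    qed
  qed
  then obtain c where c: "c = [] \<or> (\<exists>l. c = [l])" "c \<odot> rev ?X \<odot> ginv c = ?X"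
      "c \<odot> rev ?Y \<odot> ginv c = ?Y"
    by blast
  then have "reduced c" by (auto simp: reduced_Cons)
  then have "c \<odot> rev u \<odot> ginv c = u"
    unfolding w(1) using rev_subst_word[of ?X ?Y c w] c(2,3) w(2) by simp
  then show ?thesis
    using c(1) red palindrome_cyclically_shortest twisted_palindrome_cyclically_shortest by auto
qed

text \<open>Both words are cyclically shortest, so they are rotations of each other and contain the
  same signed letters.\<close>

lemma palindromic_conjugate_positive:
  assumes "\<eta> \<noteq> \<eta>'" "positive u" "conjugate u u'" "palindromic \<eta> \<eta>' u'"
  shows "positive u'"
proof -
  obtain g where "reduced g" "u' = g \<odot> u \<odot> ginv g" using assms(3) unfolding conjugate_def by auto
  moreover have "cyclically_shortest u'" by (rule palindromic_cyclically_shortest) fact+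
  ultimately show ?thesis
    using cyclically_shortest_conjugate_rotate[of u g] assms(2)
    unfolding positive_def by (metis set_rotate)
qed

subsection \<open>Generator pairs\<close>

lemma generator_pair_iff:
  "generator_pair (u, v) \<longleftrightarrow> reduced u \<and> reduced v \<and>
     (\<forall>g. reduced g \<longrightarrow> (\<exists>!w. reduced w \<and> subst_word u v w = g))"
  by (simp add: generator_pair_def Ball_def)

lemma generator_pair_generating:
  assumes "generator_pair (u, v)"
  shows "generating u v" "generating v u"
proof -
  show "generating u v"
    unfolding generating_def
  proof (intro allI impI)
    fix H x assume H: "subgroup H F2" "u \<in> H" "v \<in> H" "reduced x"
    then obtain w where "subst_word u v w = x"
      using assms unfolding generator_pair_iff by metis
    then show "x \<in> H" using subst_word_in_subgroup[OF H(1-3)] by blast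
  qed
  then show "generating v u" unfolding generating_def by blast
qed

text \<open>Substitution commutes with conjugation, so representing \<open>g\<close> in the new pair
  amounts to representing \<open>h^-1 g h\<close> in the old one.\<close>

lemma generator_pair_conj:
  assumes "generator_pair (u, v)" "reduced h"
  shows "generator_pair (h \<odot> u \<odot> ginv h, h \<odot> v \<odot> ginv h)"
proof -
  have red: "reduced u" "reduced v" using assms(1) by (auto simp: generator_pair_iff)
  have eq: "subst_word (h \<odot> u \<odot> ginv h) (h \<odot> v \<odot> ginv h) w = h \<odot> subst_word u v w \<odot> ginv h" for w
  proof (induction w)
    case (Cons l w)
    have "letter_val (h \<odot> u \<odot> ginv h) (h \<odot> v \<odot> ginv h) l = h \<odot> letter_val u v l \<odot> ginv h"
      using red assms(2) by (simp add: letter_val_def Let_def F2_simps)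
    then show ?case using Cons red assms(2) by (simp add: subst_word_Cons F2_simps)
  qed (use assms(2) in simp)
  have solve: "h \<odot> x \<odot> ginv h = g \<longleftrightarrow> x = ginv h \<odot> g \<odot> h" if "reduced g" "reduced x" for g x
    using that assms(2) by (auto simp: F2_simps)
  have "\<exists>!w. reduced w \<and> h \<odot> subst_word u v w \<odot> ginv h = g" if "reduced g" for g
  proof -
    have "\<exists>!w. reduced w \<and> subst_word u v w = ginv h \<odot> g \<odot> h"
      using assms(1) reduced_mult unfolding generator_pair_iff by blast
    then show ?thesis by (simp only: solve[OF that reduced_subst_word])
  qed
  then show ?thesis by (simp add: generator_pair_iff eq)
qed

text \<open>With equal types, all exponent vectors modulo 2 would be multiples of a single one,
  while those of \<open>a\<close> and \<open>b\<close> are independent.\<close>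

lemma generating_distinct_types:
  assumes "generating u v" "reduced u" "reduced v" "has_type u \<eta>" "has_type v \<eta>'"
  shows "\<eta> \<noteq> \<eta>'"
proof
  assume "\<eta> = \<eta>'"
  obtain w where w: "gen_a = subst_word u v w" using generatingE[OF assms(1-3)] by (metis reduced_gens(1))
  obtain z where z: "gen_b = subst_word u v z" using generatingE[OF assms(1-3)] by (metis reduced_gens(2))
  have "exponent_sum La gen_a = 1" "exponent_sum Lb gen_a = 0"
    "exponent_sum La gen_b = 0" "exponent_sum Lb gen_b = 1"
    by (simp_all add: gen_a_def gen_b_def exponent_sum_Cons)
  then have "odd (exponent_sum La (subst_word u v w))" "even (exponent_sum Lb (subst_word u v w))"
    "even (exponent_sum La (subst_word u v z))" "odd (exponent_sum Lb (subst_word u v z))"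
    unfolding w[symmetric] z[symmetric] by simp_all
  then show False
    using assms \<open>\<eta> = \<eta>'\<close> by (cases \<eta>) (auto simp: exponent_sum_subst_word)
qed

theorem proposition6p2:
  shows "(\<forall>u \<eta> \<eta>'. primitive u \<and> positive u \<and> has_type u \<eta> \<and> \<eta>' \<noteq> \<eta> \<longrightarrow>
            (\<exists>!u'. conjugate u u' \<and> positive u' \<and> palindromic \<eta> \<eta>' u'))
       \<and> (\<forall>u v \<eta> \<eta>'. generator_pair (u, v) \<and> positive_pair (u, v) \<and> has_type u \<eta> \<and> has_type v \<eta>' \<longrightarrow>
            (\<exists>!p. generator_pair p \<and> conjugate_pair (u, v) p \<and> positive_pair p \<and> palindromic_pair \<eta> \<eta>' p))"
proof (intro conjI allI impI)
  fix u \<eta> \<eta>'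
  assume "primitive u \<and> positive u \<and> has_type u \<eta> \<and> \<eta>' \<noteq> \<eta>"
  then have u: "primitive u" "positive u" "has_type u \<eta>" and neq: "\<eta> \<noteq> \<eta>'" by auto
  obtain v where v: "generating u v" "reduced u" "reduced v"
    using u(1) generator_pair_generating generator_pair_iff unfolding primitive_def by metis
  obtain g where g: "reduced g" "palindromic \<eta> \<eta>' (g \<odot> u \<odot> ginv g)"
    using palindromic_conjugate_exists[OF neq v u(3)] by blast
  show "\<exists>!u'. conjugate u u' \<and> positive u' \<and> palindromic \<eta> \<eta>' u'"
  proof (rule ex1I)
    have "conjugate u (g \<odot> u \<odot> ginv g)" using g(1) by (auto simp: conjugate_def)
    then show "conjugate u (g \<odot> u \<odot> ginv g) \<and> positive (g \<odot> u \<odot> ginv g) \<and>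
        palindromic \<eta> \<eta>' (g \<odot> u \<odot> ginv g)"
      using palindromic_conjugate_positive[OF neq u(2)] g(2) by blast
    then show "u' = g \<odot> u \<odot> ginv g" if "conjugate u u' \<and> positive u' \<and> palindromic \<eta> \<eta>' u'" for u'
      using palindromic_conjugate_unique[OF neq v(2)] u(3) that by blast
  qed
next
  fix u v \<eta> \<eta>'
  assume "generator_pair (u, v) \<and> positive_pair (u, v) \<and> has_type u \<eta> \<and> has_type v \<eta>'"
  then have gp: "generator_pair (u, v)" and pos: "positive u" "positive v"
    and ty: "has_type u \<eta>" "has_type v \<eta>'"
    by (auto simp: positive_pair_def)
  have gen: "generating u v" "reduced u" "reduced v"
    using generator_pair_generating(1)[OF gp] gp by (auto simp: generator_pair_iff)
  have neq: "\<eta> \<noteq> \<eta>'" by (rule generating_distinct_types[OF gen ty])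
  obtain g where g: "reduced g" "palindromic \<eta> \<eta>' (g \<odot> u \<odot> ginv g)" "palindromic \<eta> \<eta>' (g \<odot> v \<odot> ginv g)"
    using palindromic_conjugate_pair_exists[OF neq gen ty] by blast
  let ?p = "(g \<odot> u \<odot> ginv g, g \<odot> v \<odot> ginv g)"
  have conj: "conjugate u (fst p)" "conjugate v (snd p)" if "conjugate_pair (u, v) p" for p
    using that unfolding conjugate_pair_def conjugate_def by auto
  have pg: "conjugate_pair (u, v) ?p" using g(1) by (auto simp: conjugate_pair_def)
  show "\<exists>!p. generator_pair p \<and> conjugate_pair (u, v) p \<and> positive_pair p \<and> palindromic_pair \<eta> \<eta>' p"
  proof (rule ex1I)
    have "positive (fst ?p)" "positive (snd ?p)"
      using palindromic_conjugate_positive[OF neq] pos conj[OF pg] g(2,3) by auto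
    then show "generator_pair ?p \<and> conjugate_pair (u, v) ?p \<and> positive_pair ?p \<and>
        palindromic_pair \<eta> \<eta>' ?p"
      using generator_pair_conj[OF gp g(1)] pg g(2,3)
      by (simp add: positive_pair_def palindromic_pair_def)
  next
    fix p
    assume "generator_pair p \<and> conjugate_pair (u, v) p \<and> positive_pair p \<and> palindromic_pair \<eta> \<eta>' p"
    then have p: "conjugate_pair (u, v) p" "palindromic \<eta> \<eta>' (fst p)" "palindromic \<eta> \<eta>' (snd p)"
      by (auto simp: palindromic_pair_def)
    \<comment> \<open>Simultaneous conjugacy implies conjugacy of the entries, so uniqueness for
      single elements settles each entry separately.\<close>
    have "fst p = fst ?p"
      by (rule palindromic_conjugate_unique[OF neq gen(2)])
        (use ty p g conj(1)[OF p(1)] conj(1)[OF pg] in auto)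
    moreover have "snd p = snd ?p"
      by (rule palindromic_conjugate_unique[OF neq gen(3)])
        (use ty p g conj(2)[OF p(1)] conj(2)[OF pg] in auto)
    ultimately show "p = ?p" by (rule prod_eqI)
  qed
qed

end
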